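(* Let the data $Z_1,\dots,Z_n$ be random real-valued functions on $\mathbb{R}^2$ and let $$g_{ij}=\operatorname*{argmin}_{g\in SO(2)}\|Z_i-g\circ Z_j\|_2^2 .$$ (1) Suppose that $Z_i$ and $Z_j$ are independent, and that each random variable has a distribution that is invariant under the action of $SO(2)$. Then $g_{ij}$ and $Z_i$ are independent and so are $g_{ij}$ and $Z_j$. Furthermore, $g_{ij}$ is uniformly distributed on $SO(2)$. (2) Suppose that $Z_i$, $Z_j$ and $Z_k$ are independent, each random variable having a distribution that is invariant under the action of $SO(2)$. Then $g_{ij}$ and $g_{ik}$ are independent, and so are $g_{ij}$ and $g_{jk}$. Furthermore, when $Z_1,\dots,Z_n$ are all independent with distributions invariant under the action of $SO(2)$, for fixed $i$ the random variables $\{g_{ij}\}_{1\le j\le n,\ j\ne i}$ are jointly independent.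
   Context: $SO(2)$ acts on functions $Z$ on $\mathbb{R}^2$ by $(g\circ Z)(x)=Z(gx)$ for $x\in\mathbb{R}^2$. The distribution of $Z$ is invariant under the action of $SO(2)$ if $g\circ Z$ has the same law as $Z$ for every $g\in SO(2)$. $\|\cdot\|_2$ is the $L^2$ norm. The indices $i,j,k$ are distinct. *)

theory Defs
  imports "HOL-Probability.Probability"
begin

definition SO2 :: "(real^2^2) set" where
  "SO2 = {g. rotation_matrix g}"

definition SO2_borel :: "(real^2^2) measure" where
  "SO2_borel = restrict_space borel SO2"

definition rotation_by :: "real \<Rightarrow> real^2^2" where
  "rotation_by t = vector [vector [cos t, - sin t], vector [sin t, cos t]]"

(* Normalised Haar measure on SO(2): the law of the rotation by a uniform angle in [0, 2 pi). *)
definition uniform_SO2 :: "(real^2^2) measure" where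
  "uniform_SO2 = distr (uniform_measure lborel {0..<2 * pi}) SO2_borel rotation_by"

definition SO2_act :: "real^2^2 \<Rightarrow> (real^2 \<Rightarrow> real) \<Rightarrow> (real^2 \<Rightarrow> real)" where
  "SO2_act g f = (\<lambda>x. f (g *v x))"

definition L2_functions :: "(real^2 \<Rightarrow> real) set" where
  "L2_functions = {f \<in> borel_measurable lebesgue. integrable lebesgue (\<lambda>x. (f x)\<^sup>2)}"

definition L2_norm :: "(real^2 \<Rightarrow> real) \<Rightarrow> real" where
  "L2_norm f = sqrt (\<integral>x. (f x)\<^sup>2 \<partial>lebesgue)"

(* Openness for the pseudometric of the L2 norm. Functions are not identified when they agree
   almost everywhere; instead, open sets are saturated under that relation. *)
definition L2_open :: "(real^2 \<Rightarrow> real) set \<Rightarrow> bool" where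
  "L2_open U \<longleftrightarrow> U \<subseteq> L2_functions \<and>
     (\<forall>f\<in>U. \<exists>e>0. \<forall>h\<in>L2_functions. L2_norm (\<lambda>x. h x - f x) < e \<longrightarrow> h \<in> U)"

definition L2_borel :: "(real^2 \<Rightarrow> real) measure" where
  "L2_borel = sigma L2_functions {U. L2_open U}"

definition alignment_cost ::
    "(real^2 \<Rightarrow> real) \<Rightarrow> (real^2 \<Rightarrow> real) \<Rightarrow> real^2^2 \<Rightarrow> real" where
  "alignment_cost f h g = (L2_norm (\<lambda>x. f x - SO2_act g h x))\<^sup>2"

(* The argmin over SO(2) exists, is unique, and equals g. *)
definition is_alignment ::
    "(real^2 \<Rightarrow> real) \<Rightarrow> (real^2 \<Rightarrow> real) \<Rightarrow> real^2^2 \<Rightarrow> bool" where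
  "is_alignment f h g \<longleftrightarrow>
     {g'. is_arg_min (alignment_cost f h) (\<lambda>g'. g' \<in> SO2) g'} = {g}"

context prob_space
begin

definition rotation_invariant :: "('a \<Rightarrow> real^2 \<Rightarrow> real) \<Rightarrow> bool" where
  "rotation_invariant Z \<longleftrightarrow>
     (\<forall>g\<in>SO2. distr M L2_borel (\<lambda>\<omega>. SO2_act g (Z \<omega>)) = distr M L2_borel Z)"

(* The library's indep_var requires both variables to take values in the same type. *)
definition indep_var_het ::
    "'b measure \<Rightarrow> ('a \<Rightarrow> 'b) \<Rightarrow> 'c measure \<Rightarrow> ('a \<Rightarrow> 'c) \<Rightarrow> bool" where
  "indep_var_het N X K Y \<longleftrightarrow>
     random_variable N X \<and> random_variable K Y \<and>
     indep_set {X -` A \<inter> space M | A. A \<in> sets N} {Y -` B \<inter> space M | B. B \<in> sets K}"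

end

end

theory Submission
  imports Defs
begin

text \<open>
  The proof rests on equivariance. Write \<open>g(f, h)\<close> for the rotation that aligns \<open>h\<close> with \<open>f\<close>.
  Rotating \<open>h\<close> by \<open>k\<close> turns \<open>g(f, h)\<close> into \<open>k\<^sup>-\<^sup>1 g(f, h)\<close>. Suppose \<open>W\<close> has a rotation-invariant
  law and is independent of \<open>X\<close>, and \<open>f\<close> depends on \<open>X\<close> only. Then \<open>(X, W)\<close> and \<open>(X, k W)\<close> have the
  same law, so for every event \<open>E\<close> about \<open>X\<close> the measure \<open>B \<mapsto> P(g(f, W) \<in> B, E)\<close> is
  invariant under all rotations. By uniqueness of Haar measure it equals \<open>P(E)\<close> times the uniform
  law (\<open>alignment_uniform_given\<close>): conditionally on \<open>X\<close>, the alignment is uniform.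

  Everything else is a choice of \<open>X\<close>. Taking \<open>X = Z\<^sub>i\<close> and \<open>W = Z\<^sub>j\<close> shows that \<open>g\<^sub>i\<^sub>j\<close> is uniform and
  independent of \<open>Z\<^sub>i\<close>; independence from \<open>Z\<^sub>j\<close> follows by exchanging the two functions, which
  replaces the alignment by its inverse. For several alignments, \<open>X\<close> collects all the functions
  but one, \<open>Z\<^sub>l\<close>: an alignment that involves \<open>Z\<^sub>l\<close> is uniform given all alignments that do not
  (\<open>alignment_uniform_given_others\<close>). This gives the pairwise claims at once, and joint
  independence of \<open>g\<^sub>i\<^sub>j\<close> for fixed \<open>i\<close> by removing one index \<open>j\<close> after the other.

  The analytic work is to show that an event about \<open>g(f, h)\<close> is an event about the pair \<open>(f, h)\<close>
  (\<open>alignment_in_Borel\<close>), measurable for the \<^emph>\<open>product\<close> of the two Borel structures. It needs two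
  facts about \<open>L\<^sup>2\<close>. By separability, \<open>(f, h) \<mapsto> \<parallel>f - h\<parallel>\<close> is product measurable. By strong
  continuity of the rotation action, the cost is continuous in the rotation, so a minimum over a
  compact set of rotations can be tested on a countable dense subset. Both facts come from an
  induction principle for \<open>L\<^sup>2\<close> (\<open>L2_functions_induct\<close>) that starts from indicators of boxes.
\<close>

section \<open>Square-integrable functions\<close>

lemma L2_functionsI:
  "f \<in> borel_measurable lebesgue \<Longrightarrow> integrable lebesgue (\<lambda>x. (f x)\<^sup>2) \<Longrightarrow> f \<in> L2_functions"
  by (simp add: L2_functions_def)

lemma L2_functionsD:
  assumes "f \<in> L2_functions"
  shows "f \<in> borel_measurable lebesgue" "integrable lebesgue (\<lambda>x. (f x)\<^sup>2)"
  using assms by (simp_all add: L2_functions_def)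

lemma L2_functions_dominated:
  assumes "w \<in> L2_functions" "f \<in> borel_measurable lebesgue" "AE x in lebesgue. \<bar>f x\<bar> \<le> \<bar>w x\<bar>"
  shows "f \<in> L2_functions"
proof (rule L2_functionsI)
  note [measurable] = assms(2)
  show "integrable lebesgue (\<lambda>x. (f x)\<^sup>2)"
    using assms(3) by (intro Bochner_Integration.integrable_bound[OF L2_functionsD(2)[OF assms(1)]])
      (auto simp: abs_le_square_iff)
qed fact

lemma L2_functions_scale:
  assumes "f \<in> L2_functions" shows "(\<lambda>x. c * f x) \<in> L2_functions"
  using L2_functionsD[OF assms] by (intro L2_functionsI) (auto simp: power_mult_distrib)

text \<open>
  Young's inequality with a free ratio of weights. Integrated, it gives both that sums of
  square-integrable functions are square-integrable and, with \<open>a\<close> and \<open>b\<close> slightly above the two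
  norms, the triangle inequality.
\<close>
lemma square_add_le:
  fixes x y a b :: real
  assumes "0 < a" "0 < b"
  shows "(x + y)\<^sup>2 \<le> (1 + b / a) * x\<^sup>2 + (1 + a / b) * y\<^sup>2"
proof -
  have "(1 + b / a) * x\<^sup>2 + (1 + a / b) * y\<^sup>2 - (x + y)\<^sup>2 = (b * x - a * y)\<^sup>2 / (a * b)"
    using assms by (simp add: field_simps power2_eq_square)
  moreover have "\<dots> \<ge> 0" using assms by simp
  ultimately show ?thesis by linarith
qed

lemma L2_functions_add:
  assumes f: "f \<in> L2_functions" and h: "h \<in> L2_functions"
  shows "(\<lambda>x. f x + h x) \<in> L2_functions"
proof (rule L2_functionsI)
  note [measurable] = L2_functionsD(1)[OF f] L2_functionsD(1)[OF h]
  show "(\<lambda>x. f x + h x) \<in> borel_measurable lebesgue" by simp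
  show "integrable lebesgue (\<lambda>x. (f x + h x)\<^sup>2)"
  proof (rule Bochner_Integration.integrable_bound)
    show "integrable lebesgue (\<lambda>x. 2 * (f x)\<^sup>2 + 2 * (h x)\<^sup>2)"
      using L2_functionsD(2)[OF f] L2_functionsD(2)[OF h] by simp
    show "AE x in lebesgue. norm ((f x + h x)\<^sup>2) \<le> norm (2 * (f x)\<^sup>2 + 2 * (h x)\<^sup>2)"
      using square_add_le[of 1 1] by (auto simp: abs_of_nonneg)
  qed simp
qed

lemma L2_functions_diff:
  assumes "f \<in> L2_functions" "h \<in> L2_functions"
  shows "(\<lambda>x. f x - h x) \<in> L2_functions"
  using L2_functions_add[OF assms(1) L2_functions_scale[OF assms(2), of "-1"]] by simp

lemma L2_norm_nonneg [simp]: "0 \<le> L2_norm f"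
  by (simp add: L2_norm_def)

lemma L2_norm_square: "(L2_norm f)\<^sup>2 = (\<integral>x. (f x)\<^sup>2 \<partial>lebesgue)"
  by (simp add: L2_norm_def)

lemma L2_norm_scale: "L2_norm (\<lambda>x. c * f x) = \<bar>c\<bar> * L2_norm f"
  by (simp add: L2_norm_def power_mult_distrib real_sqrt_mult)

text \<open>
  The bound is proved for all \<open>a\<close> and \<open>b\<close> strictly above the two norms, so that functions of norm
  zero need no separate treatment in the quotient \<open>b / a\<close>.
\<close>
lemma L2_norm_triangle:
  assumes f: "f \<in> L2_functions" and h: "h \<in> L2_functions"
  shows "L2_norm (\<lambda>x. f x + h x) \<le> L2_norm f + L2_norm h"
proof (rule field_le_epsilon)
  fix e :: real assume e: "0 < e"
  define a where "a = L2_norm f + e / 2"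
  define b where "b = L2_norm h + e / 2"
  have a: "0 < a" "L2_norm f \<le> a" and b: "0 < b" "L2_norm h \<le> b"
    using e by (auto simp: a_def b_def add_nonneg_pos)
  have "(L2_norm (\<lambda>x. f x + h x))\<^sup>2 = (\<integral>x. (f x + h x)\<^sup>2 \<partial>lebesgue)"
    by (rule L2_norm_square)
  also have "\<dots> \<le> (\<integral>x. (1 + b / a) * (f x)\<^sup>2 + (1 + a / b) * (h x)\<^sup>2 \<partial>lebesgue)"
    using L2_functionsD(2)[OF f] L2_functionsD(2)[OF h] L2_functionsD(2)[OF L2_functions_add[OF f h]]
      square_add_le[OF a(1) b(1)]
    by (intro integral_mono) auto
  also have "\<dots> = (1 + b / a) * (L2_norm f)\<^sup>2 + (1 + a / b) * (L2_norm h)\<^sup>2"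
    using L2_functionsD(2)[OF f] L2_functionsD(2)[OF h] by (simp add: L2_norm_square)
  also have "\<dots> \<le> (1 + b / a) * a\<^sup>2 + (1 + a / b) * b\<^sup>2"
    using a b by (intro add_mono mult_left_mono power_mono) auto
  also have "\<dots> = (a + b)\<^sup>2"
    using a(1) b(1) by (simp add: field_simps power2_eq_square)
  finally have "L2_norm (\<lambda>x. f x + h x) \<le> a + b"
    using a b by (simp add: power2_le_iff_abs_le)
  then show "L2_norm (\<lambda>x. f x + h x) \<le> L2_norm f + L2_norm h + e"
    by (simp add: a_def b_def)
qed

lemma L2_norm_diff_commute: "L2_norm (\<lambda>x. f x - h x) = L2_norm (\<lambda>x. h x - f x)"
  by (simp add: L2_norm_def power2_commute)

lemma L2_dist_triangle:
  assumes "f \<in> L2_functions" "g \<in> L2_functions" "h \<in> L2_functions"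
  shows "L2_norm (\<lambda>x. f x - h x) \<le> L2_norm (\<lambda>x. f x - g x) + L2_norm (\<lambda>x. g x - h x)"
  using L2_norm_triangle[OF L2_functions_diff[OF assms(1,2)] L2_functions_diff[OF assms(2,3)]]
  by simp

lemma L2_norm_AE_0:
  assumes "AE x in lebesgue. f x = 0"
  shows "L2_norm f = 0"
proof -
  have "(\<integral>x. (f x)\<^sup>2 \<partial>lebesgue) = 0"
    using assms by (intro integral_eq_zero_AE) auto
  then show ?thesis by (simp add: L2_norm_def)
qed

lemma L2_dominated_convergence:
  assumes w: "w \<in> L2_functions"
    and s: "\<And>n. s n \<in> borel_measurable lebesgue" and f: "f \<in> borel_measurable lebesgue"
    and lim: "AE x in lebesgue. (\<lambda>n. s n x) \<longlonglongrightarrow> f x"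
    and bound: "\<And>n. AE x in lebesgue. \<bar>s n x\<bar> \<le> \<bar>w x\<bar>"
  shows "(\<lambda>n. L2_norm (\<lambda>x. s n x - f x)) \<longlonglongrightarrow> 0"
proof -
  note [measurable] = s f
  have bound': "AE x in lebesgue. \<forall>n. \<bar>s n x\<bar> \<le> \<bar>w x\<bar>"
    using bound by (simp add: AE_all_countable)
  have "(\<lambda>n. \<integral>x. (s n x - f x)\<^sup>2 \<partial>lebesgue) \<longlonglongrightarrow> (\<integral>(x::real^2). (0::real) \<partial>lebesgue)"
  proof (rule integral_dominated_convergence)
    show "integrable lebesgue (\<lambda>x. 4 * (w x)\<^sup>2)"
      using L2_functionsD(2)[OF w] by simp
    show "AE x in lebesgue. (\<lambda>n. (s n x - f x)\<^sup>2) \<longlonglongrightarrow> 0"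
      using lim
    proof eventually_elim
      case (elim x)
      have "(\<lambda>n. (s n x - f x)\<^sup>2) \<longlonglongrightarrow> (f x - f x)\<^sup>2"
        by (intro tendsto_intros elim)
      then show ?case by simp
    qed
    fix n
    show "AE x in lebesgue. norm ((s n x - f x)\<^sup>2) \<le> 4 * (w x)\<^sup>2"
      using lim bound'
    proof eventually_elim
      case (elim x)
      have "(\<lambda>n. \<bar>s n x\<bar>) \<longlonglongrightarrow> \<bar>f x\<bar>"
        by (intro tendsto_intros elim)
      then have "\<bar>f x\<bar> \<le> \<bar>w x\<bar>"
        by (rule LIMSEQ_le_const2) (use elim in auto)
      moreover have "\<bar>s n x\<bar> \<le> \<bar>w x\<bar>" using elim by blast
      ultimately have "\<bar>s n x - f x\<bar> \<le> \<bar>2 * w x\<bar>" by linarith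
      then have "(s n x - f x)\<^sup>2 \<le> (2 * w x)\<^sup>2" by (simp only: abs_le_square_iff)
      then show ?case by (simp add: power_mult_distrib)
    qed
  qed simp_all
  then show ?thesis
    unfolding L2_norm_def using tendsto_real_sqrt by fastforce
qed

text \<open>
  Boxes are indexed by the four rational coordinates of two opposite corners, so that their
  countability is that of the index type.
\<close>
definition rational_box :: "rat \<times> rat \<times> rat \<times> rat \<Rightarrow> (real^2) set" where
  "rational_box = (\<lambda>(p, q, r, s). box (vector [of_rat p, of_rat q]) (vector [of_rat r, of_rat s]))"

lemma mem_rational_box:
  "x \<in> rational_box (p, q, r, s) \<longleftrightarrow>
     of_rat p < x $ 1 \<and> x $ 1 < of_rat r \<and> of_rat q < x $ 2 \<and> x $ 2 < of_rat s"
  by (auto simp: rational_box_def mem_box_cart forall_2)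

lemma rational_box_measurable [measurable]: "rational_box p \<in> sets borel"
  by (cases p) (simp add: rational_box_def)

lemma Int_stable_rational_box: "Int_stable (range rational_box)"
proof (rule Int_stableI)
  fix A B assume "A \<in> range rational_box" "B \<in> range rational_box"
  then obtain p q r s p' q' r' s'
    where AB: "A = rational_box (p, q, r, s)" "B = rational_box (p', q', r', s')"
    by (metis imageE prod_cases4)
  have max: "of_rat (max u v) < y \<longleftrightarrow> of_rat u < y \<and> of_rat v < y"
    and min: "y < of_rat (min u v) \<longleftrightarrow> y < of_rat u \<and> y < of_rat v" for u v :: rat and y :: real
    using of_rat_less_eq[of u v, where 'a=real] of_rat_less_eq[of v u, where 'a=real]
    by (auto simp: max_def min_def)
  have "A \<inter> B = rational_box (max p p', max q q', min r r', min s s')"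
    by (auto simp: AB mem_rational_box max min)
  then show "A \<inter> B \<in> range rational_box" by simp
qed

lemma borel_eq_rational_box: "sets (borel :: (real^2) measure) = sigma_sets UNIV (range rational_box)"
proof -
  have "(borel :: (real^2) measure) = sigma UNIV (rational_box ` UNIV)"
  proof (rule borel_eq_sigmaI1[OF borel_def])
    fix S :: "(real^2) set" assume "S \<in> {S. open S}"
    then have S: "open S" by simp
    have "S = \<Union>(range rational_box \<inter> Pow S)"
    proof (intro equalityI subsetI)
      fix x assume "x \<in> S"
      with S obtain e where e: "0 < e" "ball x e \<subseteq> S"
        by (auto simp: open_contains_ball)
      obtain a b where ab: "\<forall>i\<in>Basis. a \<bullet> i \<in> \<rat> \<and> b \<bullet> i \<in> \<rat>" "x \<in> box a b" "box a b \<subseteq> ball x e"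
        using rational_boxes[OF e(1), of x] by blast
      have "a $ i \<in> \<rat>" "b $ i \<in> \<rat>" for i
        using ab(1) by (auto simp: Basis_vec_def inner_axis dest: bspec[where x="axis i 1"])
      then obtain p q r s where pq: "a $ 1 = of_rat p" "a $ 2 = of_rat q" "b $ 1 = of_rat r" "b $ 2 = of_rat s"
        by (metis Rats_cases)
      have "box a b = rational_box (p, q, r, s)"
        by (auto simp: mem_rational_box mem_box_cart forall_2 pq)
      then show "x \<in> \<Union>(range rational_box \<inter> Pow S)"
        using ab e by blast
    qed blast
    moreover have "countable (range rational_box \<inter> Pow S)" by (intro countable_Int1) auto
    ultimately show "S \<in> sets (sigma UNIV (range rational_box))"
      using sets.countable_Union[of "range rational_box \<inter> Pow S" "sigma UNIV (range rational_box)"]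
      by (auto intro: sigma_sets.Basic)
  qed auto
  then show ?thesis by (metis Pow_UNIV sets_measure_of subset_UNIV)
qed

definition central_box :: "nat \<Rightarrow> (real^2) set" where
  "central_box n = rational_box (- of_nat n, - of_nat n, of_nat n, of_nat n)"

lemma eventually_central_box: "eventually (\<lambda>n. x \<in> central_box n) sequentially"
proof -
  obtain N :: nat where "\<bar>x $ 1\<bar> + \<bar>x $ 2\<bar> < real N"
    using reals_Archimedean2 by blast
  then have "x \<in> central_box n" if "n \<ge> N" for n
    using that by (auto simp: central_box_def mem_rational_box of_rat_minus)
  then show ?thesis by (auto simp: eventually_sequentially)
qed

lemma indicator_L2:
  assumes A: "A \<in> sets lebesgue" "A \<subseteq> rational_box p"
  shows "(indicator A :: _ \<Rightarrow> real) \<in> L2_functions"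
proof (rule L2_functions_dominated)
  have "integrable lebesgue (indicator (rational_box p) :: _ \<Rightarrow> real)"
    using lmeasurable_box by (cases p) (auto simp: rational_box_def simp flip: lmeasurable_iff_integrable)
  then show "(indicator (rational_box p) :: _ \<Rightarrow> real) \<in> L2_functions"
    by (intro L2_functionsI) (auto simp: power2_eq_square indicator_inter_arith[symmetric])
qed (use A in \<open>auto simp: indicator_def\<close>)

text \<open>
  The sets \<open>A\<close> for which the property holds for the indicator of the intersection of \<open>A\<close> with a fixed
  box form a Dynkin system that contains the generator \<open>rational_box\<close>, hence contain all Borel sets.
  Cutting with a box keeps every indicator square-integrable. From there, linear combinations give
  simple functions and dominated convergence gives everything else; the limit case also absorbs
  changes on null sets.
\<close>
lemma L2_functions_induct [consumes 1, case_names box add scale limit]: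
  assumes f: "f \<in> L2_functions"
    and box: "\<And>p. P (indicator (rational_box p))"
    and add: "\<And>f h. f \<in> L2_functions \<Longrightarrow> h \<in> L2_functions \<Longrightarrow> P f \<Longrightarrow> P h \<Longrightarrow> P (\<lambda>x. f x + h x)"
    and scale: "\<And>f c. f \<in> L2_functions \<Longrightarrow> P f \<Longrightarrow> P (\<lambda>x. c * f x)"
    and limit: "\<And>s f. (\<And>n. s n \<in> L2_functions) \<Longrightarrow> (\<And>n. P (s n)) \<Longrightarrow> f \<in> L2_functions \<Longrightarrow>
       (\<lambda>n. L2_norm (\<lambda>x. s n x - f x)) \<longlonglongrightarrow> 0 \<Longrightarrow> P f"
  shows "P f"
proof -
  have zero_L2: "(\<lambda>x. 0) \<in> L2_functions" by (rule L2_functionsI) auto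
  have zero: "P (\<lambda>x. 0)"
    using scale[OF indicator_L2[OF _ order_refl] box, of _ 0] by simp
  have sum: "(\<lambda>x. \<Sum>i\<in>I. h i x) \<in> L2_functions \<and> P (\<lambda>x. \<Sum>i\<in>I. h i x)"
    if "finite I" "\<And>i. i \<in> I \<Longrightarrow> h i \<in> L2_functions" "\<And>i. i \<in> I \<Longrightarrow> P (h i)" for I :: "'i set" and h
    using that by (induction I rule: finite_induct) (auto simp: zero zero_L2 intro: add L2_functions_add)
  have ind: "P (indicator (A \<inter> rational_box p))" if "A \<in> sets borel" for A p
  proof -
    have L2: "A \<in> sets borel \<Longrightarrow> (indicator (A \<inter> rational_box p) :: _ \<Rightarrow> real) \<in> L2_functions" for A
      by (rule indicator_L2) auto
    have "A \<in> sigma_sets UNIV (range rational_box)"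
      using that by (simp add: borel_eq_rational_box)
    with Int_stable_rational_box subset_UNIV[of "range rational_box", folded Pow_UNIV]
    show ?thesis
    proof (induction rule: sigma_sets_induct_disjoint)
      case (basic A)
      then have "A \<inter> rational_box p \<in> range rational_box"
        by (intro Int_stableD[OF Int_stable_rational_box]) auto
      then show ?case using box by auto
    next
      case empty
      then show ?case using zero by (simp add: indicator_def)
    next
      case (compl A)
      then have A: "A \<in> sets borel" by (simp add: borel_eq_rational_box)
      have "P (\<lambda>x. indicator (rational_box p) x + (-1) * indicator (A \<inter> rational_box p) x)"
        using A L2[of UNIV] by (intro add scale box compl L2 L2_functions_scale) auto
      moreover have "(\<lambda>x. indicator (rational_box p) x + (-1) * indicator (A \<inter> rational_box p) x :: real)
        = indicator ((UNIV - A) \<inter> rational_box p)"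
        by (auto simp: fun_eq_iff indicator_def)
      ultimately show ?case by simp
    next
      case (union A)
      have A: "A i \<in> sets borel" for i
        using union(2) by (auto simp: borel_eq_rational_box)
      then have UA: "\<Union>(range A) \<in> sets borel" by blast
      let ?s = "\<lambda>n x. \<Sum>i<n. indicator (A i \<inter> rational_box p) x :: real"
      have disj: "i = j" if "x \<in> A i" "x \<in> A j" for x i j
        using union(1) that by (auto simp: disjoint_family_on_def)
      have eq: "?s n x = indicator ((\<Union>i<n. A i) \<inter> rational_box p) x" for n x
      proof (induction n)
        case (Suc n)
        have "?s (Suc n) x = indicator ((\<Union>i<n. A i) \<inter> rational_box p) x + indicator (A n \<inter> rational_box p) x"
          by (simp only: sum.lessThan_Suc Suc.IH)
        also have "\<dots> = indicator ((\<Union>i<Suc n. A i) \<inter> rational_box p) x"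
          by (auto simp: indicator_def lessThan_Suc dest: disj)
        finally show ?case .
      qed simp
      have sL2: "?s n \<in> L2_functions \<and> P (?s n)" for n
        by (rule sum) (use union L2[OF A] in auto)
      show ?case
      proof (rule limit[of ?s])
        show "(\<lambda>n. L2_norm (\<lambda>x. ?s n x - indicator (\<Union> (range A) \<inter> rational_box p) x)) \<longlonglongrightarrow> 0"
        proof (rule L2_dominated_convergence)
          show "(indicator (UNIV \<inter> rational_box p) :: _ \<Rightarrow> real) \<in> L2_functions"
            by (rule L2) simp
          show "AE x in lebesgue. (\<lambda>n. ?s n x) \<longlonglongrightarrow> indicator (\<Union> (range A) \<inter> rational_box p) x"
          proof (rule AE_I2)
            fix x
            have "\<forall>\<^sub>F n in sequentially. (indicator (\<Union> (range A) \<inter> rational_box p) x :: real) = ?s n x"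
            proof (cases "x \<in> \<Union> (range A)")
              case True
              then obtain i where "x \<in> A i" by auto
              then have "\<forall>n\<ge>Suc i. indicator (\<Union> (range A) \<inter> rational_box p) x = ?s n x"
                unfolding eq by (auto simp: indicator_def)
              then show ?thesis unfolding eventually_sequentially by blast
            qed (auto simp: eq indicator_def)
            then show "(\<lambda>n. ?s n x) \<longlonglongrightarrow> indicator (\<Union> (range A) \<inter> rational_box p) x"
              by (rule tendsto_eventually[OF eventually_mono]) simp
          qed
          show "AE x in lebesgue. \<bar>?s n x\<bar> \<le> \<bar>indicator (UNIV \<inter> rational_box p) x\<bar>" for n
            unfolding eq by (auto simp: indicator_def)
        qed (use sL2 L2_functionsD(1) L2[OF UA] in blast)+
      qed (use L2[OF UA] sL2 in auto)
    qed
  qed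
  obtain f' where f': "f' \<in> borel_measurable lborel" "AE x in lborel. f x = f' x"
    using completion_ex_borel_measurable_real[OF L2_functionsD(1)[OF f]] by blast
  have ae: "AE x in lebesgue. f x = f' x" using f'(2) by (rule AE_completion)
  have f'L2: "f' \<in> L2_functions"
    using ae f'(1) by (intro L2_functions_dominated[OF f]) (auto intro: measurable_completion elim: eventually_mono)
  obtain s where s: "\<And>n. simple_function lborel (s n)" "\<And>x. (\<lambda>n. s n x) \<longlonglongrightarrow> f' x"
    "\<And>n x. \<bar>s n x\<bar> \<le> 2 * \<bar>f' x\<bar>"
    using borel_measurable_implies_sequence_metric[OF f'(1), of 0] by (auto simp: dist_norm)
  note [measurable] = f'(1) borel_measurable_simple_function[OF s(1)]
  \<comment> \<open>cut the simple approximations with growing boxes, so that each level set has finite measure\<close>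
  define t where "t n x = (\<Sum>y\<in>range (s n). y * indicator (s n -` {y} \<inter> central_box n) x)" for n x
  have t_eq: "t n x = s n x * indicator (central_box n) x" for n x
  proof -
    have "t n x = (\<Sum>y\<in>range (s n). if y = s n x then y * indicator (central_box n) x else 0)"
      unfolding t_def by (intro sum.cong) (auto simp: indicator_def)
    then show ?thesis using simple_functionD(1)[OF s(1)] by (simp add: sum.delta')
  qed
  have meas: "s n -` {y} \<in> sets borel" for n y
    using simple_functionD(2)[OF s(1), of n "{y}"] by simp
  have t: "t n \<in> L2_functions \<and> P (t n)" for n
    unfolding t_def using simple_functionD(1)[OF s(1), of n] meas
    by (intro sum) (auto simp: central_box_def intro!: scale ind L2_functions_scale indicator_L2)
  show ?thesis
  proof (rule limit[of t])
    have "(\<lambda>n. L2_norm (\<lambda>x. t n x - f x)) \<longlonglongrightarrow> 0"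
    proof (rule L2_dominated_convergence)
      show "(\<lambda>x. 2 * f' x) \<in> L2_functions" by (rule L2_functions_scale) fact
      show "AE x in lebesgue. (\<lambda>n. t n x) \<longlonglongrightarrow> f x"
        using ae
      proof eventually_elim
        case (elim x)
        have "\<forall>\<^sub>F n in sequentially. t n x = s n x"
          using eventually_central_box[of x] by eventually_elim (simp add: t_eq)
        then show ?case using s(2)[of x] elim by (simp add: tendsto_cong)
      qed
      show "AE x in lebesgue. \<bar>t n x\<bar> \<le> \<bar>2 * f' x\<bar>" for n
        using s(3)[of n] by (auto simp: t_eq indicator_def abs_mult)
    qed (use t f L2_functionsD in auto)
    then show "(\<lambda>n. L2_norm (\<lambda>x. t n x - f x)) \<longlonglongrightarrow> 0" .
  qed (use t f in auto)
qed

section \<open>The rotation group and its invariant measure\<close>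

lemma rotation_by_nth:
  "rotation_by t $ 1 $ 1 = cos t" "rotation_by t $ 1 $ 2 = - sin t"
  "rotation_by t $ 2 $ 1 = sin t" "rotation_by t $ 2 $ 2 = cos t"
  by (simp_all add: rotation_by_def)

lemma rotation_by_add: "rotation_by s ** rotation_by t = rotation_by (s + t)"
  by (simp add: vec_eq_iff forall_2 matrix_matrix_mult_def sum_2 rotation_by_nth cos_add sin_add)

lemma rotation_by_in_SO2: "rotation_by t \<in> SO2"
proof -
  have "transpose (rotation_by t) = rotation_by (- t)"
    by (simp add: vec_eq_iff forall_2 transpose_def rotation_by_nth)
  moreover have "rotation_by 0 = mat 1"
    by (simp add: vec_eq_iff forall_2 rotation_by_nth mat_def)
  ultimately have "orthogonal_matrix (rotation_by t)"
    by (simp add: orthogonal_matrix_def rotation_by_add)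
  moreover have "det (rotation_by t) = 1"
    by (simp add: det_2 rotation_by_nth flip: power2_eq_square)
  ultimately show ?thesis by (simp add: SO2_def rotation_matrix_def)
qed

text \<open>
  The orthonormality relations and \<open>det g = 1\<close> combine to \<open>(a - d)\<^sup>2 + (b + c)\<^sup>2 = 0\<close> for the entries
  \<open>a, b, c, d\<close>, which leaves a single point \<open>(a, c)\<close> on the unit circle.
\<close>
lemma SO2_eq_rotation_by:
  assumes "g \<in> SO2"
  obtains t where "0 \<le> t" "t < 2 * pi" "g = rotation_by t"
proof -
  have g: "transpose g ** g = mat 1" "det g = 1"
    using assms by (auto simp: SO2_def rotation_matrix_def orthogonal_matrix_def)
  define a b c d where "a = g $ 1 $ 1" and "b = g $ 1 $ 2" and "c = g $ 2 $ 1" and "d = g $ 2 $ 2"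
  have eqs: "a\<^sup>2 + c\<^sup>2 = 1" "b\<^sup>2 + d\<^sup>2 = 1" "a * d - b * c = 1"
    using g by (auto simp: a_def b_def c_def d_def det_2 vec_eq_iff forall_2 matrix_matrix_mult_def
        sum_2 transpose_def mat_def power2_eq_square)
  have "(a - d)\<^sup>2 + (b + c)\<^sup>2 = (a\<^sup>2 + c\<^sup>2) + (b\<^sup>2 + d\<^sup>2) - 2 * (a * d - b * c)"
    by (simp add: power2_eq_square algebra_simps)
  also have "\<dots> = 0" using eqs by simp
  finally have "d = a" "b = - c" by (auto simp: sum_power2_eq_zero_iff)
  obtain t where t: "0 \<le> t" "t < 2 * pi" "a = cos t" "c = sin t"
    using sincos_total_2pi[OF eqs(1)] by blast
  have "g = rotation_by t"
    using t \<open>d = a\<close> \<open>b = - c\<close>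
    by (auto simp: vec_eq_iff forall_2 rotation_by_nth a_def b_def c_def d_def)
  with t that show ?thesis by blast
qed

lemma continuous_on_rotation_by: "continuous_on S rotation_by"
  unfolding continuous_on_def
proof
  fix x
  show "(rotation_by \<longlongrightarrow> rotation_by x) (at x within S)"
  proof (rule vec_tendstoI, rule vec_tendstoI)
    fix i j :: 2
    have "i = 1 \<or> i = 2" "j = 1 \<or> j = 2" by (auto simp: exhaust_2)
    then show "((\<lambda>t. rotation_by t $ i $ j) \<longlongrightarrow> rotation_by x $ i $ j) (at x within S)"
      by (elim disjE; simp only: rotation_by_nth; intro tendsto_intros)
  qed
qed

lemma compact_SO2: "compact SO2"
proof -
  have "SO2 = rotation_by ` {0..2 * pi}"
    by (auto simp: rotation_by_in_SO2 elim!: SO2_eq_rotation_by)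
  then show ?thesis
    by (metis compact_continuous_image continuous_on_rotation_by compact_Icc)
qed

lemma space_SO2_borel [simp]: "space SO2_borel = SO2"
  by (simp add: SO2_borel_def space_restrict_space)

lemma sets_SO2_borel: "B \<in> sets SO2_borel \<longleftrightarrow> B \<in> sets borel \<and> B \<subseteq> SO2"
  using compact_SO2 by (auto simp: SO2_borel_def sets_restrict_space_iff compact_imp_closed borel_closed)

lemma rotation_by_measurable [measurable]: "rotation_by \<in> borel \<rightarrow>\<^sub>M SO2_borel"
  unfolding SO2_borel_def
  by (intro measurable_restrict_space2 borel_measurable_continuous_onI continuous_on_rotation_by)
    (auto simp: rotation_by_in_SO2)

lemma emeasure_lborel_shift:
  fixes A :: "real set"
  assumes [measurable]: "A \<in> sets borel"
  shows "emeasure lborel {t. t + c \<in> A} = emeasure lborel A"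
proof -
  have "emeasure lborel A = emeasure (distr lborel borel ((+) c)) A"
    by (simp add: lborel_distr_plus)
  also have "\<dots> = emeasure lborel {t. t + c \<in> A}"
    by (subst emeasure_distr) (auto simp: vimage_def add.commute)
  finally show ?thesis ..
qed

text \<open>
  Shifting moves the window of length \<open>p\<close> to \<open>{s..<p + s}\<close>; the part of it beyond \<open>p\<close> is carried back
  to \<open>{0..<s}\<close> by periodicity.
\<close>
lemma emeasure_periodic_shift:
  assumes [measurable]: "T \<in> sets borel" and periodic: "\<And>t::real. t + p \<in> T \<longleftrightarrow> t \<in> T"
    and s: "0 \<le> s" "s < p"
  shows "emeasure lborel ({0..<p} \<inter> {t. t + s \<in> T}) = emeasure lborel ({0..<p} \<inter> T)"
proof -
  have "{0..<p} \<inter> {t. t + s \<in> T} = {t. t + s \<in> {s..<p + s} \<inter> T}"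
    by auto
  also have "emeasure lborel \<dots> = emeasure lborel ({s..<p + s} \<inter> T)"
    by (rule emeasure_lborel_shift) simp
  also have "{s..<p + s} \<inter> T = ({s..<p} \<inter> T) \<union> ({p..<p + s} \<inter> T)"
    using s by auto
  also have "emeasure lborel \<dots> = emeasure lborel ({s..<p} \<inter> T) + emeasure lborel ({p..<p + s} \<inter> T)"
    by (rule plus_emeasure[symmetric]) auto
  also have "emeasure lborel ({p..<p + s} \<inter> T) = emeasure lborel {t. t + p \<in> {p..<p + s} \<inter> T}"
    by (rule emeasure_lborel_shift[symmetric]) simp
  also have "{t. t + p \<in> {p..<p + s} \<inter> T} = {0..<s} \<inter> T"
    using periodic by auto
  also have "emeasure lborel ({s..<p} \<inter> T) + emeasure lborel ({0..<s} \<inter> T)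
      = emeasure lborel (({s..<p} \<inter> T) \<union> ({0..<s} \<inter> T))"
    by (rule plus_emeasure) auto
  also have "({s..<p} \<inter> T) \<union> ({0..<s} \<inter> T) = {0..<p} \<inter> T"
    using s by auto
  finally show ?thesis .
qed

lemma uniform_angle_prob_space: "prob_space (uniform_measure lborel {0..<2 * pi})"
  by (rule prob_space_uniform_measure) auto

lemma uniform_SO2_prob_space: "prob_space uniform_SO2"
  unfolding uniform_SO2_def
  by (rule prob_space.prob_space_distr[OF uniform_angle_prob_space]) (simp cong: measurable_cong_sets)

lemma uniform_SO2_shift:
  assumes B: "B \<in> sets SO2_borel" and g: "g \<in> SO2"
  shows "emeasure (uniform_measure lborel {0..<2 * pi}) {t. rotation_by t ** g \<in> B} = emeasure uniform_SO2 B"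
proof -
  obtain s where s: "0 \<le> s" "s < 2 * pi" "g = rotation_by s"
    using SO2_eq_rotation_by[OF g] .
  let ?T = "{t. rotation_by t \<in> B}"
  have [measurable]: "?T \<in> sets borel"
    using measurable_sets[OF rotation_by_measurable B] by (simp add: vimage_def)
  have "(\<lambda>t. t + s) -` ?T \<inter> space borel \<in> sets borel"
    by (rule measurable_sets[of _ borel]) measurable
  then have [measurable]: "{t. t + s \<in> ?T} \<in> sets borel" by (simp add: vimage_def)
  have "rotation_by (t + 2 * pi) = rotation_by t" for t
    by (simp add: rotation_by_def)
  then have "emeasure lborel ({0..<2 * pi} \<inter> {t. t + s \<in> ?T}) = emeasure lborel ({0..<2 * pi} \<inter> ?T)"
    using s by (intro emeasure_periodic_shift) auto
  moreover have "{t. rotation_by t ** g \<in> B} = {t. t + s \<in> ?T}"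
    by (simp add: s(3) rotation_by_add)
  moreover have "emeasure uniform_SO2 B = emeasure (uniform_measure lborel {0..<2 * pi}) ?T"
    unfolding uniform_SO2_def using B by (subst emeasure_distr) (auto simp: vimage_def)
  moreover have "emeasure (uniform_measure lborel {0..<2 * pi}) A
      = emeasure lborel ({0..<2 * pi} \<inter> A) / emeasure lborel {0..<2 * pi}" if "A \<in> sets borel" for A
    using that by (intro emeasure_uniform_measure) auto
  ultimately show ?thesis
    using \<open>?T \<in> sets borel\<close> \<open>{t. t + s \<in> ?T} \<in> sets borel\<close> by metis
qed

lemma SO2_shift_measurable:
  assumes B: "B \<in> sets SO2_borel"
  shows "{x \<in> SO2. k ** x \<in> B} \<in> sets SO2_borel"
proof -
  have "(\<lambda>x. k ** x) \<in> borel_measurable borel"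
    by (rule borel_measurable_continuous_onI) (auto simp: matrix_matrix_mult_def intro!: continuous_intros)
  from measurable_sets[OF this, of B] have "{x. k ** x \<in> B} \<in> sets borel"
    using B by (simp add: vimage_def sets_SO2_borel)
  moreover have "{x \<in> SO2. k ** x \<in> B} = SO2 \<inter> {x. k ** x \<in> B}" by auto
  ultimately show ?thesis
    using compact_SO2 by (auto simp: sets_SO2_borel compact_imp_closed)
qed

text \<open>
  Uniqueness of Haar measure. Average \<open>\<nu> {x. k x \<in> B} = \<nu> B\<close> over a uniform rotation \<open>k\<close> and
  exchange the integrals: for each \<open>x\<close> the inner integral becomes the probability that \<open>k x \<in> B\<close>,
  which is the uniform measure of \<open>B\<close> by shift invariance.
\<close>
lemma uniform_SO2_unique:
  assumes "finite_measure \<nu>" and sets: "sets \<nu> = sets SO2_borel"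
    and inv: "\<And>k B. k \<in> SO2 \<Longrightarrow> B \<in> sets SO2_borel \<Longrightarrow> emeasure \<nu> {x \<in> SO2. k ** x \<in> B} = emeasure \<nu> B"
    and B: "B \<in> sets SO2_borel"
  shows "emeasure \<nu> B = emeasure uniform_SO2 B * emeasure \<nu> SO2"
proof -
  interpret \<nu>: finite_measure \<nu> by fact
  let ?P = "uniform_measure lborel {0..<2 * pi}"
  interpret P: prob_space ?P by (rule uniform_angle_prob_space)
  interpret pair_sigma_finite ?P \<nu> ..
  have space: "space \<nu> = SO2" using sets_eq_imp_space_eq[OF sets] by simp
  have "(\<lambda>(t, x). rotation_by t ** x) \<in> borel \<Otimes>\<^sub>M borel \<rightarrow>\<^sub>M (borel :: (real^2^2) measure)"
    unfolding borel_prod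
    by (rule borel_measurable_continuous_onI)
      (auto simp: split_beta matrix_matrix_mult_def intro!: continuous_intros continuous_on_compose2[OF continuous_on_rotation_by])
  moreover have "(\<lambda>p. p) \<in> ?P \<Otimes>\<^sub>M \<nu> \<rightarrow>\<^sub>M borel \<Otimes>\<^sub>M (borel :: (real^2^2) measure)"
  proof (rule measurable_pair)
    have "snd \<in> ?P \<Otimes>\<^sub>M \<nu> \<rightarrow>\<^sub>M SO2_borel"
      using measurable_snd[of ?P \<nu>] by (simp cong: measurable_cong_sets add: sets)
    then show "snd \<circ> (\<lambda>p. p) \<in> ?P \<Otimes>\<^sub>M \<nu> \<rightarrow>\<^sub>M (borel :: (real^2^2) measure)"
      unfolding SO2_borel_def by (simp add: measurable_restrict_space2_iff comp_def)
    have "fst \<in> ?P \<Otimes>\<^sub>M \<nu> \<rightarrow>\<^sub>M ?P" by (rule measurable_fst)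
    then show "fst \<circ> (\<lambda>p. p) \<in> ?P \<Otimes>\<^sub>M \<nu> \<rightarrow>\<^sub>M borel"
      by (simp cong: measurable_cong_sets add: comp_def)
  qed
  ultimately have mult: "(\<lambda>(t, x). rotation_by t ** x) \<in> ?P \<Otimes>\<^sub>M \<nu> \<rightarrow>\<^sub>M (borel :: (real^2^2) measure)"
    by (rule measurable_compose[rotated])
  have B': "B \<in> sets borel" using B by (simp add: sets_SO2_borel)
  have meas: "(\<lambda>(t, x). indicator B (rotation_by t ** x) :: ennreal) \<in> borel_measurable (?P \<Otimes>\<^sub>M \<nu>)"
    using measurable_compose[OF mult borel_measurable_indicator[OF B']] by (simp add: case_prod_beta')
  have sect: "{x \<in> SO2. rotation_by t ** x \<in> B} \<in> sets \<nu>" for t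
    unfolding sets by (rule SO2_shift_measurable[OF B])
  have sect': "{t. rotation_by t ** x \<in> B} \<in> sets ?P" if "x \<in> SO2" for x
  proof -
    have "(\<lambda>t. rotation_by t ** x) \<in> borel_measurable borel"
      by (rule borel_measurable_continuous_onI)
        (auto simp: matrix_matrix_mult_def intro!: continuous_intros continuous_on_rotation_by)
    from measurable_sets[OF this B'] show ?thesis by (simp add: vimage_def)
  qed
  have "(\<integral>\<^sup>+t. \<integral>\<^sup>+x. indicator B (rotation_by t ** x) \<partial>\<nu> \<partial>?P) = (\<integral>\<^sup>+t. emeasure \<nu> B \<partial>?P)"
  proof (rule nn_integral_cong)
    fix t
    have "(\<integral>\<^sup>+x. indicator B (rotation_by t ** x) \<partial>\<nu>) = (\<integral>\<^sup>+x. indicator {x \<in> SO2. rotation_by t ** x \<in> B} x \<partial>\<nu>)"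
      by (rule nn_integral_cong) (simp add: space indicator_def)
    also have "\<dots> = emeasure \<nu> B"
      using sect inv[OF rotation_by_in_SO2 B] by simp
    finally show "(\<integral>\<^sup>+x. indicator B (rotation_by t ** x) \<partial>\<nu>) = emeasure \<nu> B" .
  qed
  moreover have "(\<integral>\<^sup>+x. \<integral>\<^sup>+t. indicator B (rotation_by t ** x) \<partial>?P \<partial>\<nu>) = (\<integral>\<^sup>+x. emeasure uniform_SO2 B \<partial>\<nu>)"
  proof (rule nn_integral_cong)
    fix x assume "x \<in> space \<nu>"
    then have x: "x \<in> SO2" by (simp add: space)
    have "(\<integral>\<^sup>+t. indicator B (rotation_by t ** x) \<partial>?P) = (\<integral>\<^sup>+t. indicator {t. rotation_by t ** x \<in> B} t \<partial>?P)"
      by (rule nn_integral_cong) (simp add: indicator_def)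
    also have "\<dots> = emeasure uniform_SO2 B"
      using sect'[OF x] uniform_SO2_shift[OF B x] by simp
    finally show "(\<integral>\<^sup>+t. indicator B (rotation_by t ** x) \<partial>?P) = emeasure uniform_SO2 B" .
  qed
  ultimately show ?thesis
    using Fubini'[OF meas] P.emeasure_space_1 by (simp add: space)
qed

section \<open>Rotations acting on square-integrable functions\<close>

lemma SO2_iff: "g \<in> SO2 \<longleftrightarrow> orthogonal_matrix g \<and> det g = 1"
  by (simp add: SO2_def rotation_matrix_def)

lemma SO2_mult: "g \<in> SO2 \<Longrightarrow> h \<in> SO2 \<Longrightarrow> g ** h \<in> SO2"
  by (simp add: SO2_iff orthogonal_matrix_mul det_mul)

lemma SO2_transpose: "g \<in> SO2 \<Longrightarrow> transpose g \<in> SO2"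
  by (simp add: SO2_iff det_transpose)

lemma transpose_measurable [measurable]:
  "(transpose :: real^2^2 \<Rightarrow> real^2^2) \<in> SO2_borel \<rightarrow>\<^sub>M SO2_borel"
proof -
  have "(transpose :: real^2^2 \<Rightarrow> real^2^2) \<in> borel_measurable borel"
    by (rule borel_measurable_continuous_onI) (auto simp: transpose_def intro!: continuous_intros)
  then show ?thesis
    unfolding SO2_borel_def
    by (intro measurable_restrict_space2 measurable_restrict_space1) (auto simp: space_restrict_space SO2_transpose)
qed

lemma SO2_transpose_inverse:
  assumes "g \<in> SO2" shows "g ** transpose g = mat 1" "transpose g ** g = mat 1"
  using assms by (auto simp: SO2_iff orthogonal_matrix_def)

lemma SO2_norm:
  assumes "g \<in> SO2" shows "norm (g *v x) = norm x"
proof -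
  have "orthogonal_transformation (\<lambda>x. g *v x)"
    using assms by (simp add: SO2_iff orthogonal_transformation_matrix)
  then show ?thesis by (rule orthogonal_transformation_norm)
qed

lemma SO2_vimage:
  assumes "g \<in> SO2" shows "(\<lambda>x. g *v x) -` A = (\<lambda>x. transpose g *v x) ` A"
proof -
  have inv: "g *v (transpose g *v x) = x" "transpose g *v (g *v x) = x" for x
    by (simp_all add: matrix_vector_mul_assoc SO2_transpose_inverse[OF assms] del: transpose_matrix_vector)
  show ?thesis
  proof (intro set_eqI iffI)
    fix x assume "x \<in> (\<lambda>x. g *v x) -` A"
    then show "x \<in> (\<lambda>x. transpose g *v x) ` A"
      by (intro image_eqI[where x="g *v x"]) (simp_all only: inv vimage_eq)
  next
    fix x assume "x \<in> (\<lambda>x. transpose g *v x) ` A"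
    then obtain y where "y \<in> A" "x = transpose g *v y" by blast
    then show "x \<in> (\<lambda>x. g *v x) -` A" by (simp only: inv vimage_eq)
  qed
qed

lemma distr_lborel_rotation:
  assumes g: "g \<in> SO2"
  shows "distr lborel lborel (\<lambda>x. g *v x) = lborel"
proof (rule lborel_eqI[symmetric])
  fix l u :: "real^2" assume lu: "\<And>b. b \<in> Basis \<Longrightarrow> l \<bullet> b \<le> u \<bullet> b"
  have orth: "orthogonal_transformation (\<lambda>x. transpose g *v x)"
    using SO2_transpose[OF g] by (simp add: SO2_iff orthogonal_transformation_matrix del: transpose_matrix_vector)
  let ?T = "(\<lambda>x. transpose g *v x) ` box l u"
  have meas: "(\<lambda>x. g *v x) -` box l u \<in> sets borel"
    by (intro measurable_sets_borel[OF borel_measurable_continuous_onI]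
        matrix_vector_mult_linear_continuous_on) simp
  have "emeasure (distr lborel lborel (\<lambda>x. g *v x)) (box l u) = emeasure lborel ?T"
    by (subst emeasure_distr) (auto simp: SO2_vimage[OF g] intro!: borel_measurable_continuous_onI continuous_intros)
  also have "\<dots> = emeasure lebesgue ?T"
    using meas SO2_vimage[OF g] by simp
  also have "\<dots> = ennreal (measure lebesgue ?T)"
    using measurable_orthogonal_image[OF orth, of "box l u"] by (intro emeasure_eq_measure2) simp
  also have "\<dots> = ennreal (measure lebesgue (box l u))"
    by (subst measure_orthogonal_image[OF orth]) simp_all
  also have "\<dots> = (\<Prod>b\<in>Basis. (u - l) \<bullet> b)"
    using lu by (simp add: measure_def emeasure_lborel_box)
  finally show "emeasure (distr lborel lborel (\<lambda>x. g *v x)) (box l u) = (\<Prod>b\<in>Basis. (u - l) \<bullet> b)" .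
qed simp

lemma distr_lebesgue_rotation:
  assumes g: "g \<in> SO2"
  shows "(\<lambda>x. g *v x) \<in> lebesgue \<rightarrow>\<^sub>M lebesgue"
    and "distr lebesgue lebesgue (\<lambda>x. g *v x) = lebesgue"
proof -
  have m: "(\<lambda>x. g *v x) \<in> lborel \<rightarrow>\<^sub>M lborel"
    by (auto intro!: borel_measurable_continuous_onI continuous_intros)
  have d: "distr lebesgue lborel (\<lambda>x. g *v x) = lborel"
    by (simp only: distr_completion[OF m] distr_lborel_rotation[OF g])
  have m': "(\<lambda>x. g *v x) \<in> lebesgue \<rightarrow>\<^sub>M lborel"
    using m by (rule measurable_completion)
  show "(\<lambda>x. g *v x) \<in> lebesgue \<rightarrow>\<^sub>M lebesgue"
    by (rule completion.measurable_completion2[OF m']) (simp add: d)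
  show "distr lebesgue lebesgue (\<lambda>x. g *v x) = lebesgue"
    using completion.completion_distr_eq[OF m'] by (simp add: d)
qed

lemma L2_norm_SO2_act:
  assumes "g \<in> SO2" "f \<in> borel_measurable lebesgue"
  shows "L2_norm (SO2_act g f) = L2_norm f"
proof -
  have "(\<integral>x. (f x)\<^sup>2 \<partial>distr lebesgue lebesgue (\<lambda>x. g *v x)) = (\<integral>x. (f (g *v x))\<^sup>2 \<partial>lebesgue)"
    using assms distr_lebesgue_rotation(1)[OF assms(1)] by (intro integral_distr) auto
  then show ?thesis
    by (simp add: L2_norm_def SO2_act_def distr_lebesgue_rotation[OF assms(1)])
qed

lemma SO2_act_L2:
  assumes "g \<in> SO2" "f \<in> L2_functions"
  shows "SO2_act g f \<in> L2_functions"
proof (rule L2_functionsI)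
  note [measurable] = L2_functionsD(1)[OF assms(2)] distr_lebesgue_rotation(1)[OF assms(1)]
  show "SO2_act g f \<in> borel_measurable lebesgue"
    unfolding SO2_act_def by measurable
  have "integrable (distr lebesgue lebesgue (\<lambda>x. g *v x)) (\<lambda>x. (f x)\<^sup>2)"
    using L2_functionsD(2)[OF assms(2)] by (simp add: distr_lebesgue_rotation[OF assms(1)])
  then show "integrable lebesgue (\<lambda>x. (SO2_act g f x)\<^sup>2)"
    unfolding SO2_act_def by (subst (asm) integrable_distr_eq) auto
qed

lemma L2_dist_SO2_act:
  assumes "g \<in> SO2" "f \<in> L2_functions" "h \<in> L2_functions"
  shows "L2_norm (\<lambda>x. SO2_act g f x - SO2_act g h x) = L2_norm (\<lambda>x. f x - h x)"
  using L2_norm_SO2_act[OF assms(1) L2_functionsD(1)[OF L2_functions_diff[OF assms(2,3)]]]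
  by (simp add: SO2_act_def)

text \<open>
  Strong continuity of the action. For the indicator of a box, the rotated indicators converge
  outside the preimage of the boundary of the box, a null set because the box is convex, and they
  are dominated by the indicator of one larger box because rotations preserve the norm. The general
  case follows because rotations are isometries, so that approximation is uniform in the rotation.
\<close>
lemma SO2_act_tendsto:
  assumes f: "f \<in> L2_functions"
    and \<gamma>: "\<And>n. \<gamma> n \<in> SO2" and g: "g \<in> SO2" and lim: "\<gamma> \<longlonglongrightarrow> g"
  shows "(\<lambda>n. L2_norm (\<lambda>x. SO2_act (\<gamma> n) f x - SO2_act g f x)) \<longlonglongrightarrow> 0"
  using f
proof (induction rule: L2_functions_induct)
  case (box p)
  let ?B = "rational_box p"
  obtain a b where B: "?B = box a b"
    by (cases p) (simp add: rational_box_def)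
  have bounded: "bounded ?B" and convex: "convex ?B" and "open": "open ?B"
    by (simp_all add: B open_box)
  obtain R where R: "\<And>x. x \<in> ?B \<Longrightarrow> norm x \<le> R"
    using bounded by (auto simp: bounded_iff)
  obtain N :: nat where N: "R < real N" using reals_Archimedean2 by blast
  have act: "SO2_act k (indicator ?B) \<in> borel_measurable lebesgue" if "k \<in> SO2" for k
    by (intro L2_functionsD(1) SO2_act_L2 that indicator_L2) auto
  show ?case
  proof (rule L2_dominated_convergence)
    show "(indicator (central_box N) :: _ \<Rightarrow> real) \<in> L2_functions"
      unfolding central_box_def by (rule indicator_L2) auto
    have "AE x in distr lebesgue lebesgue (\<lambda>x. g *v x). x \<notin> frontier ?B"
      using negligible_convex_frontier[OF convex] distr_lebesgue_rotation(2)[OF g]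
      by (simp add: negligible_iff_null_sets AE_not_in)
    moreover have "{x. x \<notin> frontier ?B} \<in> sets lebesgue"
      by (intro sets_completionI_sets) (simp add: Collect_neg_eq)
    ultimately have "AE x in lebesgue. g *v x \<notin> frontier ?B"
      using distr_lebesgue_rotation(1)[OF g] by (subst (asm) AE_distr_iff) auto
    then show "AE x in lebesgue. (\<lambda>n. SO2_act (\<gamma> n) (indicator ?B) x) \<longlonglongrightarrow> SO2_act g (indicator ?B) x"
    proof eventually_elim
      case (elim x)
      have lim': "(\<lambda>n. \<gamma> n *v x) \<longlonglongrightarrow> g *v x"
        by (intro vec_tendstoI) (auto simp: matrix_vector_mult_def intro!: tendsto_intros lim)
      have "\<forall>\<^sub>F n in sequentially. \<gamma> n *v x \<in> ?B \<longleftrightarrow> g *v x \<in> ?B"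
      proof (cases "g *v x \<in> ?B")
        case True
        show ?thesis
          using topological_tendstoD[OF lim' "open" True] by eventually_elim (simp add: True)
      next
        case False
        with elim "open" have "g *v x \<in> - closure ?B"
          by (simp add: frontier_def interior_open)
        then have "\<forall>\<^sub>F n in sequentially. \<gamma> n *v x \<in> - closure ?B"
          by (intro topological_tendstoD[OF lim']) auto
        then show ?thesis
          by eventually_elim (use False closure_subset in auto)
      qed
      then have "\<forall>\<^sub>F n in sequentially.
          SO2_act (\<gamma> n) (indicator ?B) x = (SO2_act g (indicator ?B) x :: real)"
        by eventually_elim (simp add: SO2_act_def indicator_def)
      then show ?case by (rule tendsto_eventually)
    qed
    fix n
    have "x \<in> central_box N" if "\<gamma> n *v x \<in> ?B" for x
    proof -
      have "norm x < real N" using R[OF that] N by (simp add: SO2_norm[OF \<gamma>])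
      then have "\<bar>x $ i\<bar> < real N" for i
        using component_le_norm_cart[of x i] by linarith
      from this[of 1] this[of 2] show ?thesis
        by (auto simp: central_box_def mem_rational_box of_rat_minus)
    qed
    then show "AE x in lebesgue. \<bar>SO2_act (\<gamma> n) (indicator ?B) x\<bar> \<le> \<bar>indicator (central_box N) x\<bar>"
      by (auto simp: SO2_act_def indicator_def)
  qed (use act \<gamma> g in auto)
next
  case (add f h)
  show ?case
  proof (rule tendsto_sandwich[OF _ _ tendsto_const])
    show "(\<lambda>n. L2_norm (\<lambda>x. SO2_act (\<gamma> n) f x - SO2_act g f x)
        + L2_norm (\<lambda>x. SO2_act (\<gamma> n) h x - SO2_act g h x)) \<longlonglongrightarrow> 0"
      using tendsto_add[OF add(3,4)] by simp
    show "\<forall>\<^sub>F n in sequentially. L2_norm (\<lambda>x. SO2_act (\<gamma> n) (\<lambda>x. f x + h x) x - SO2_act g (\<lambda>x. f x + h x) x)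
      \<le> L2_norm (\<lambda>x. SO2_act (\<gamma> n) f x - SO2_act g f x)
        + L2_norm (\<lambda>x. SO2_act (\<gamma> n) h x - SO2_act g h x)"
    proof (rule always_eventually, rule allI)
      fix n
      have "L2_norm (\<lambda>x. (SO2_act (\<gamma> n) f x - SO2_act g f x) + (SO2_act (\<gamma> n) h x - SO2_act g h x))
        \<le> L2_norm (\<lambda>x. SO2_act (\<gamma> n) f x - SO2_act g f x) + L2_norm (\<lambda>x. SO2_act (\<gamma> n) h x - SO2_act g h x)"
        by (intro L2_norm_triangle L2_functions_diff SO2_act_L2 add \<gamma> g)
      then show "L2_norm (\<lambda>x. SO2_act (\<gamma> n) (\<lambda>x. f x + h x) x - SO2_act g (\<lambda>x. f x + h x) x)
        \<le> L2_norm (\<lambda>x. SO2_act (\<gamma> n) f x - SO2_act g f x)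
          + L2_norm (\<lambda>x. SO2_act (\<gamma> n) h x - SO2_act g h x)"
        by (simp add: SO2_act_def algebra_simps)
    qed
  qed simp
next
  case (scale f c)
  have "L2_norm (\<lambda>x. SO2_act (\<gamma> n) (\<lambda>x. c * f x) x - SO2_act g (\<lambda>x. c * f x) x)
      = \<bar>c\<bar> * L2_norm (\<lambda>x. SO2_act (\<gamma> n) f x - SO2_act g f x)" for n
    by (simp add: SO2_act_def L2_norm_scale flip: right_diff_distrib)
  then show ?case
    using tendsto_mult_left[OF scale(2), of "\<bar>c\<bar>"] by simp
next
  case (limit s f)
  show ?case
  proof (rule LIMSEQ_I)
    fix e :: real assume e: "0 < e"
    obtain m where m: "L2_norm (\<lambda>x. s m x - f x) < e / 3"
      using LIMSEQ_D[OF limit.hyps(3), of "e / 3"] e by auto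
    obtain n0 where n0: "\<And>n. n \<ge> n0 \<Longrightarrow> L2_norm (\<lambda>x. SO2_act (\<gamma> n) (s m) x - SO2_act g (s m) x) < e / 3"
      using LIMSEQ_D[OF limit.IH[of m], of "e / 3"] e by auto
    have "L2_norm (\<lambda>x. SO2_act (\<gamma> n) f x - SO2_act g f x) < e" if "n \<ge> n0" for n
    proof -
      note L2 = SO2_act_L2[OF \<gamma>[of n]] SO2_act_L2[OF g] limit.hyps(1)[of m] limit.hyps(2)
      have "L2_norm (\<lambda>x. SO2_act (\<gamma> n) f x - SO2_act g f x)
          \<le> L2_norm (\<lambda>x. SO2_act (\<gamma> n) f x - SO2_act (\<gamma> n) (s m) x)
            + L2_norm (\<lambda>x. SO2_act (\<gamma> n) (s m) x - SO2_act g f x)"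
        by (intro L2_dist_triangle L2)
      moreover have "L2_norm (\<lambda>x. SO2_act (\<gamma> n) (s m) x - SO2_act g f x)
          \<le> L2_norm (\<lambda>x. SO2_act (\<gamma> n) (s m) x - SO2_act g (s m) x)
            + L2_norm (\<lambda>x. SO2_act g (s m) x - SO2_act g f x)"
        by (intro L2_dist_triangle L2)
      moreover have "L2_norm (\<lambda>x. SO2_act (\<gamma> n) f x - SO2_act (\<gamma> n) (s m) x) = L2_norm (\<lambda>x. s m x - f x)"
        using L2_dist_SO2_act[OF \<gamma> limit.hyps(2) limit.hyps(1)] L2_norm_diff_commute by metis
      moreover have "L2_norm (\<lambda>x. SO2_act g (s m) x - SO2_act g f x) = L2_norm (\<lambda>x. s m x - f x)"
        by (rule L2_dist_SO2_act[OF g limit.hyps(1) limit.hyps(2)])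
      ultimately show ?thesis using m n0[OF that] by linarith
    qed
    then show "\<exists>n0. \<forall>n\<ge>n0. norm (L2_norm (\<lambda>x. SO2_act (\<gamma> n) f x - SO2_act g f x) - 0) < e"
      by auto
  qed
qed

section \<open>The Borel structure\<close>

primrec rational_step :: "(rat \<times> rat \<times> rat \<times> rat \<times> rat) list \<Rightarrow> real^2 \<Rightarrow> real" where
  "rational_step [] x = 0"
| "rational_step (cp # cps) x = of_rat (fst cp) * indicator (rational_box (snd cp)) x + rational_step cps x"

lemma rational_step_L2: "rational_step cps \<in> L2_functions"
proof (induction cps)
  case Nil
  then show ?case by (intro L2_functionsI) auto
next
  case (Cons cp cps)
  have "(\<lambda>x. of_rat (fst cp) * indicator (rational_box (snd cp)) x + rational_step cps x) \<in> L2_functions"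
    by (intro L2_functions_add L2_functions_scale indicator_L2 Cons) auto
  moreover have "rational_step (cp # cps) = (\<lambda>x. of_rat (fst cp) * indicator (rational_box (snd cp)) x + rational_step cps x)"
    by (rule ext) simp
  ultimately show ?case by simp
qed

lemma rational_step_append: "rational_step (xs @ ys) x = rational_step xs x + rational_step ys x"
  by (induction xs) auto

lemma rational_step_scale:
  "rational_step (map (\<lambda>(a, p). (c * a, p)) xs) x = of_rat c * rational_step xs x"
  by (induction xs) (auto simp: of_rat_mult algebra_simps)

text \<open>
  Separability: the step functions are indexed by lists over a countable type.
\<close>
lemma rational_step_dense:
  assumes "f \<in> L2_functions" "0 < e"
  shows "\<exists>cps. L2_norm (\<lambda>x. f x - rational_step cps x) < e"
  using assms
proof (induction arbitrary: e rule: L2_functions_induct)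
  case (box p)
  have "L2_norm (\<lambda>x. indicator (rational_box p) x - rational_step [(1, p)] x) = 0"
    by (intro L2_norm_AE_0) simp
  with box show ?case by metis
next
  case (add f h)
  obtain xs ys where xy: "L2_norm (\<lambda>x. f x - rational_step xs x) < e / 2"
      "L2_norm (\<lambda>x. h x - rational_step ys x) < e / 2"
    using add(3,4)[of "e / 2"] add(5) by auto
  have "L2_norm (\<lambda>x. (f x - rational_step xs x) + (h x - rational_step ys x))
      \<le> L2_norm (\<lambda>x. f x - rational_step xs x) + L2_norm (\<lambda>x. h x - rational_step ys x)"
    by (intro L2_norm_triangle L2_functions_diff add rational_step_L2)
  with xy have "L2_norm (\<lambda>x. (f x + h x) - rational_step (xs @ ys) x) < e"
    by (simp add: rational_step_append algebra_simps)
  then show ?case by blast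
next
  case (scale f c)
  have "((\<lambda>q. \<bar>c - q\<bar> * L2_norm f) \<longlongrightarrow> \<bar>c - c\<bar> * L2_norm f) (at c)"
    by (intro tendsto_intros)
  then have "\<forall>\<^sub>F q in at c. \<bar>c - q\<bar> * L2_norm f < e / 2"
    using scale(3) by (intro order_tendstoD(2)) auto
  then obtain d where d: "0 < d" "\<And>q. q \<noteq> c \<Longrightarrow> dist q c < d \<Longrightarrow> \<bar>c - q\<bar> * L2_norm f < e / 2"
    by (auto simp: eventually_at)
  obtain q where q: "c - d < of_rat q" "of_rat q < c"
    using of_rat_dense[of "c - d" c] d(1) by auto
  have q2: "\<bar>c - of_rat q\<bar> * L2_norm f < e / 2"
    using q by (intro d(2)) (auto simp: dist_real_def)
  define e' where "e' = e / 2 / (\<bar>of_rat q\<bar> + 1)"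
  have "0 < e'" using scale(3) by (simp add: e'_def add_nonneg_pos)
  then obtain xs where xs: "L2_norm (\<lambda>x. f x - rational_step xs x) < e'"
    using scale(2) by blast
  have "L2_norm (\<lambda>x. (c - of_rat q) * f x + of_rat q * (f x - rational_step xs x))
     \<le> L2_norm (\<lambda>x. (c - of_rat q) * f x) + L2_norm (\<lambda>x. of_rat q * (f x - rational_step xs x))"
    by (intro L2_norm_triangle L2_functions_diff L2_functions_scale scale rational_step_L2)
  also have "\<dots> = \<bar>c - of_rat q\<bar> * L2_norm f + \<bar>of_rat q\<bar> * L2_norm (\<lambda>x. f x - rational_step xs x)"
    by (simp only: L2_norm_scale)
  also have "\<bar>of_rat q :: real\<bar> * L2_norm (\<lambda>x. f x - rational_step xs x) \<le> \<bar>of_rat q\<bar> * e'"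
    using xs by (intro mult_left_mono) auto
  also have "\<bar>of_rat q\<bar> * e' \<le> e / 2"
  proof -
    have "(\<bar>of_rat q\<bar> + 1) * e' = e / 2"
      unfolding e'_def by (rule nonzero_mult_div_cancel_left[THEN trans[OF times_divide_eq_right]]) linarith
    then show ?thesis using \<open>0 < e'\<close> by (simp add: algebra_simps)
  qed
  finally have "L2_norm (\<lambda>x. (c - of_rat q) * f x + of_rat q * (f x - rational_step xs x)) < e"
    using q2 by simp
  moreover have "(\<lambda>x. (c - of_rat q) * f x + of_rat q * (f x - rational_step xs x))
      = (\<lambda>x. c * f x - rational_step (map (\<lambda>(a, p). (q * a, p)) xs) x)"
    by (simp add: fun_eq_iff rational_step_scale left_diff_distrib right_diff_distrib)
  ultimately have "L2_norm (\<lambda>x. c * f x - rational_step (map (\<lambda>(a, p). (q * a, p)) xs) x) < e"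
    by simp
  then show ?case by blast
next
  case (limit s f)
  obtain m where m: "L2_norm (\<lambda>x. s m x - f x) < e / 2"
    using LIMSEQ_D[OF limit.hyps(3), of "e / 2"] limit.prems by auto
  obtain xs where xs: "L2_norm (\<lambda>x. s m x - rational_step xs x) < e / 2"
    using limit.IH[of "e / 2" m] limit.prems by auto
  have "L2_norm (\<lambda>x. f x - rational_step xs x)
     \<le> L2_norm (\<lambda>x. f x - s m x) + L2_norm (\<lambda>x. s m x - rational_step xs x)"
    by (intro L2_dist_triangle limit.hyps rational_step_L2)
  also have "L2_norm (\<lambda>x. f x - s m x) = L2_norm (\<lambda>x. s m x - f x)"
    by (rule L2_norm_diff_commute)
  finally show ?case using m xs by (intro exI[of _ xs]) linarith
qed

lemma space_L2_borel [simp]: "space L2_borel = L2_functions"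
  unfolding L2_borel_def by (rule space_measure_of) (auto simp: L2_open_def)

lemma L2_open_measurable: "L2_open U \<Longrightarrow> U \<in> sets L2_borel"
  unfolding L2_borel_def by (subst sets_measure_of) (auto simp: L2_open_def intro: sigma_sets.Basic)

lemma L2_ball_measurable:
  assumes d: "d \<in> L2_functions"
  shows "{f \<in> L2_functions. L2_norm (\<lambda>x. f x - d x) < r} \<in> sets L2_borel"
proof (intro L2_open_measurable, unfold L2_open_def, intro conjI ballI)
  fix f assume f: "f \<in> {f \<in> L2_functions. L2_norm (\<lambda>x. f x - d x) < r}"
  have "L2_norm (\<lambda>x. h x - d x) < r"
    if "h \<in> L2_functions" "L2_norm (\<lambda>x. h x - f x) < r - L2_norm (\<lambda>x. f x - d x)" for h
    using L2_dist_triangle[of h f d] that f d by auto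
  then show "\<exists>e>0. \<forall>h\<in>L2_functions. L2_norm (\<lambda>x. h x - f x) < e \<longrightarrow>
      h \<in> {f \<in> L2_functions. L2_norm (\<lambda>x. f x - d x) < r}"
    using f by (intro exI[of _ "r - L2_norm (\<lambda>x. f x - d x)"]) auto
qed auto

text \<open>
  The distance is continuous, hence Borel on the product space; that it is measurable for the product
  of the two Borel structures needs separability. The set where it is smaller than \<open>r\<close> is a countable
  union of products of balls with a common step function as centre and rational radii adding up to \<open>r\<close>.
\<close>
lemma L2_dist_measurable:
  "(\<lambda>(f, h). L2_norm (\<lambda>x. f x - h x)) \<in> borel_measurable (L2_borel \<Otimes>\<^sub>M L2_borel)"
proof (subst borel_measurable_iff_less, rule allI)
  fix r :: real
  let ?b = "\<lambda>d r. {f \<in> L2_functions. L2_norm (\<lambda>x. f x - d x) < r}"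
  have "{w \<in> space (L2_borel \<Otimes>\<^sub>M L2_borel). (case w of (f, h) \<Rightarrow> L2_norm (\<lambda>x. f x - h x)) < r}
    = (\<Union>(cps, q)\<in>UNIV. ?b (rational_step cps) (of_rat q) \<times> ?b (rational_step cps) (r - of_rat q))"
    (is "?L = ?R")
  proof (intro equalityI subsetI)
    fix w assume "w \<in> ?L"
    then obtain f h where w: "w = (f, h)" and f: "f \<in> L2_functions" and h: "h \<in> L2_functions"
      and less: "L2_norm (\<lambda>x. f x - h x) < r"
      by (auto simp: space_pair_measure)
    define e where "e = (r - L2_norm (\<lambda>x. f x - h x)) / 3"
    have e: "0 < e" using less by (simp add: e_def)
    obtain cps where cps: "L2_norm (\<lambda>x. f x - rational_step cps x) < e"
      using rational_step_dense[OF f e] by blast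
    obtain q where q: "L2_norm (\<lambda>x. f x - rational_step cps x) < of_rat q" "of_rat q < e"
      using of_rat_dense[OF cps] by blast
    have "L2_norm (\<lambda>x. h x - rational_step cps x)
       \<le> L2_norm (\<lambda>x. h x - f x) + L2_norm (\<lambda>x. f x - rational_step cps x)"
      by (intro L2_dist_triangle f h rational_step_L2)
    also have "L2_norm (\<lambda>x. h x - f x) = r - 3 * e"
      using L2_norm_diff_commute[of h f] by (simp add: e_def field_simps)
    finally have "L2_norm (\<lambda>x. h x - rational_step cps x) < r - of_rat q"
      using q e by linarith
    with q show "w \<in> ?R" by (auto simp: w f h intro!: exI[of _ cps] exI[of _ q])
  next
    fix w assume "w \<in> ?R"
    then obtain f h cps q where w: "w = (f, h)" and f: "f \<in> L2_functions" and h: "h \<in> L2_functions"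
      and less: "L2_norm (\<lambda>x. f x - rational_step cps x) < of_rat q"
         "L2_norm (\<lambda>x. h x - rational_step cps x) < r - of_rat q"
      by auto
    have "L2_norm (\<lambda>x. f x - h x)
       \<le> L2_norm (\<lambda>x. f x - rational_step cps x) + L2_norm (\<lambda>x. rational_step cps x - h x)"
      by (intro L2_dist_triangle f h rational_step_L2)
    with less L2_norm_diff_commute[of "rational_step cps" h] show "w \<in> ?L"
      by (simp add: w f h space_pair_measure)
  qed
  also have "\<dots> \<in> sets (L2_borel \<Otimes>\<^sub>M L2_borel)"
    by (intro sets.countable_UN'') (auto intro!: pair_measureI L2_ball_measurable rational_step_L2)
  finally show "{w \<in> space (L2_borel \<Otimes>\<^sub>M L2_borel). (case w of (f, h) \<Rightarrow> L2_norm (\<lambda>x. f x - h x)) < r}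
      \<in> sets (L2_borel \<Otimes>\<^sub>M L2_borel)" .
qed

lemma SO2_act_measurable [measurable]:
  assumes g: "g \<in> SO2"
  shows "SO2_act g \<in> L2_borel \<rightarrow>\<^sub>M L2_borel"
  unfolding L2_borel_def
proof (rule measurable_measure_of, fold L2_borel_def)
  fix U assume "U \<in> {U. L2_open U}"
  then have U: "U \<subseteq> L2_functions"
    "\<And>f. f \<in> U \<Longrightarrow> \<exists>e>0. \<forall>h\<in>L2_functions. L2_norm (\<lambda>x. h x - f x) < e \<longrightarrow> h \<in> U"
    by (auto simp: L2_open_def)
  have "L2_open (SO2_act g -` U \<inter> L2_functions)"
    unfolding L2_open_def
  proof (intro conjI ballI)
    fix f assume f: "f \<in> SO2_act g -` U \<inter> L2_functions"
    then obtain e where e: "0 < e" "\<And>h. h \<in> L2_functions \<Longrightarrow> L2_norm (\<lambda>x. h x - SO2_act g f x) < e \<Longrightarrow> h \<in> U"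
      using U(2)[of "SO2_act g f"] by auto
    have "SO2_act g h \<in> U" if "h \<in> L2_functions" "L2_norm (\<lambda>x. h x - f x) < e" for h
      using that f by (intro e(2) SO2_act_L2 g) (simp_all add: L2_dist_SO2_act[OF g])
    with e(1) show "\<exists>e>0. \<forall>h\<in>L2_functions. L2_norm (\<lambda>x. h x - f x) < e \<longrightarrow> h \<in> SO2_act g -` U \<inter> L2_functions"
      by auto
  qed auto
  then show "SO2_act g -` U \<inter> space L2_borel \<in> sets L2_borel"
    by (simp add: L2_open_measurable)
qed (auto simp: L2_open_def SO2_act_L2[OF g])

section \<open>Alignments\<close>

text \<open>
  An alignment is a strict minimizer, a form that is easy to transport along bijections of the
  rotation group.
\<close>
lemma is_alignment_iff:
  "is_alignment f h g \<longleftrightarrow>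
     g \<in> SO2 \<and> (\<forall>k\<in>SO2. k \<noteq> g \<longrightarrow> alignment_cost f h g < alignment_cost f h k)"
  (is "_ \<longleftrightarrow> ?R")
proof
  assume "is_alignment f h g"
  then have eq: "\<And>k. k \<in> SO2 \<and> (\<forall>y\<in>SO2. alignment_cost f h k \<le> alignment_cost f h y) \<longleftrightarrow> k = g"
    by (auto simp: is_alignment_def is_arg_min_linorder set_eq_iff)
  show ?R
  proof (intro conjI ballI impI)
    fix k assume k: "k \<in> SO2" "k \<noteq> g"
    with eq[of k] obtain y where "y \<in> SO2" "alignment_cost f h y < alignment_cost f h k"
      by (auto simp: not_le)
    then show "alignment_cost f h g < alignment_cost f h k"
      using eq[of g] by (auto intro: le_less_trans)
  qed (use eq in auto)
next
  assume R: ?R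
  then have "alignment_cost f h g \<le> alignment_cost f h k" if "k \<in> SO2" for k
    using that by (cases "k = g") (auto intro: less_imp_le)
  with R show "is_alignment f h g"
    by (auto simp: is_alignment_def is_arg_min_linorder set_eq_iff not_less[symmetric])
qed

lemma SO2_act_act: "SO2_act g (SO2_act k f) = SO2_act (k ** g) f"
  by (simp add: SO2_act_def matrix_vector_mul_assoc)

lemma SO2_act_id: "SO2_act (mat 1) f = f"
  by (simp add: SO2_act_def)

text \<open>
  The equivariance that drives the proof: the cost of \<open>x\<close> for the rotated function is the cost of
  \<open>k x\<close> for the original one.
\<close>
lemma is_alignment_SO2_act:
  assumes al: "is_alignment f h g" and k: "k \<in> SO2"
  shows "is_alignment f (SO2_act k h) (transpose k ** g)"
proof -
  have cost: "alignment_cost f (SO2_act k h) x = alignment_cost f h (k ** x)" for x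
    by (simp add: alignment_cost_def SO2_act_act)
  have cancel: "k ** (transpose k ** x) = x" "transpose k ** (k ** x) = x" for x
    by (simp_all add: matrix_mul_assoc SO2_transpose_inverse[OF k])
  have g: "g \<in> SO2" and less: "\<And>x. x \<in> SO2 \<Longrightarrow> x \<noteq> g \<Longrightarrow> alignment_cost f h g < alignment_cost f h x"
    using al by (auto simp: is_alignment_iff)
  show ?thesis
    unfolding is_alignment_iff
  proof (intro conjI ballI impI)
    show "transpose k ** g \<in> SO2" by (intro SO2_mult SO2_transpose k g)
    fix x assume x: "x \<in> SO2" "x \<noteq> transpose k ** g"
    then have "k ** x \<noteq> g" using cancel(2)[of x] by auto
    then show "alignment_cost f (SO2_act k h) (transpose k ** g) < alignment_cost f (SO2_act k h) x"
      using less[of "k ** x"] x k by (simp add: cost cancel SO2_mult)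
  qed
qed

text \<open>
  Applying the isometry \<open>g\<close> to \<open>h - g\<^sup>-\<^sup>1 f\<close> gives \<open>g h - f\<close>.
\<close>
lemma alignment_cost_transpose:
  assumes f: "f \<in> L2_functions" and h: "h \<in> L2_functions" and g: "g \<in> SO2"
  shows "alignment_cost h f (transpose g) = alignment_cost f h g"
proof -
  have "L2_norm (\<lambda>x. h x - SO2_act (transpose g) f x)
      = L2_norm (\<lambda>x. SO2_act g h x - SO2_act g (SO2_act (transpose g) f) x)"
    using L2_dist_SO2_act[OF g h SO2_act_L2[OF SO2_transpose[OF g] f]] by simp
  also have "SO2_act g (SO2_act (transpose g) f) = f"
    by (simp add: SO2_act_act SO2_transpose_inverse[OF g] SO2_act_id)
  finally show ?thesis
    by (simp add: alignment_cost_def L2_norm_diff_commute[of f])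
qed

lemma is_alignment_transpose:
  assumes f: "f \<in> L2_functions" and h: "h \<in> L2_functions" and al: "is_alignment f h g"
  shows "is_alignment h f (transpose g)"
proof -
  have g: "g \<in> SO2" and less: "\<And>x. x \<in> SO2 \<Longrightarrow> x \<noteq> g \<Longrightarrow> alignment_cost f h g < alignment_cost f h x"
    using al by (auto simp: is_alignment_iff)
  have "alignment_cost h f (transpose g) < alignment_cost h f x" if "x \<in> SO2" "x \<noteq> transpose g" for x
  proof -
    have "transpose x \<noteq> g" using that by auto
    then have "alignment_cost f h g < alignment_cost f h (transpose x)"
      by (intro less SO2_transpose that)
    then show ?thesis
      by (simp add: alignment_cost_transpose[OF f h g] alignment_cost_transpose[OF h f that(1)])
  qed
  then show ?thesis by (simp add: is_alignment_iff SO2_transpose[OF g])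
qed

lemma alignment_cost_continuous:
  assumes f: "f \<in> L2_functions" and h: "h \<in> L2_functions"
  shows "continuous_on SO2 (alignment_cost f h)"
proof (unfold continuous_on_sequentially comp_def, intro allI ballI impI, elim conjE)
  fix \<gamma> g assume g: "g \<in> SO2" and \<gamma>: "\<forall>n::nat. \<gamma> n \<in> SO2" and lim: "\<gamma> \<longlonglongrightarrow> g"
  let ?n = "\<lambda>g. L2_norm (\<lambda>x. f x - SO2_act g h x)"
  have "(\<lambda>n. ?n (\<gamma> n) - ?n g) \<longlonglongrightarrow> 0"
  proof (rule tendsto_rabs_zero_cancel, rule tendsto_sandwich[OF _ _ tendsto_const])
    show "(\<lambda>n. L2_norm (\<lambda>x. SO2_act (\<gamma> n) h x - SO2_act g h x)) \<longlonglongrightarrow> 0"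
      using \<gamma> by (intro SO2_act_tendsto h g lim) auto
    show "\<forall>\<^sub>F n in sequentially. \<bar>?n (\<gamma> n) - ?n g\<bar> \<le> L2_norm (\<lambda>x. SO2_act (\<gamma> n) h x - SO2_act g h x)"
    proof (rule always_eventually, rule allI)
      fix n
      have L2: "SO2_act (\<gamma> n) h \<in> L2_functions" "SO2_act g h \<in> L2_functions"
        using \<gamma> g h by (auto intro: SO2_act_L2)
      show "\<bar>?n (\<gamma> n) - ?n g\<bar> \<le> L2_norm (\<lambda>x. SO2_act (\<gamma> n) h x - SO2_act g h x)"
        using L2_dist_triangle[OF f L2(1,2)] L2_dist_triangle[OF f L2(2,1)]
          L2_norm_diff_commute[of "SO2_act g h" "SO2_act (\<gamma> n) h"] by linarith
    qed
  qed simp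
  then have "(\<lambda>n. ?n (\<gamma> n)) \<longlonglongrightarrow> ?n g" by (rule LIM_zero_cancel)
  then show "(\<lambda>n. alignment_cost f h (\<gamma> n)) \<longlonglongrightarrow> alignment_cost f h g"
    unfolding alignment_cost_def by (rule tendsto_power)
qed

lemma alignment_cost_measurable [measurable]:
  assumes g: "g \<in> SO2"
  shows "(\<lambda>w. alignment_cost (fst w) (snd w) g) \<in> borel_measurable (L2_borel \<Otimes>\<^sub>M L2_borel)"
proof -
  have "(\<lambda>w. (fst w, SO2_act g (snd w))) \<in> L2_borel \<Otimes>\<^sub>M L2_borel \<rightarrow>\<^sub>M L2_borel \<Otimes>\<^sub>M L2_borel"
    using SO2_act_measurable[OF g] by measurable
  from measurable_compose[OF this L2_dist_measurable]
  show ?thesis unfolding alignment_cost_def by simp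
qed

text \<open>
  The alignment exists only for some pairs, and the set of these pairs is not shown to be measurable.
  Hence the measurable set \<open>S\<close> is required to describe the event that the alignment lies in \<open>B\<close> only
  for the pairs that have an alignment. This suffices for random functions that have one almost
  surely, and it keeps the sets \<open>B\<close> that admit an \<open>S\<close> closed under complements and countable unions.
\<close>
definition determines_alignment ::
    "(real^2^2) set \<Rightarrow> ((real^2 \<Rightarrow> real) \<times> (real^2 \<Rightarrow> real)) set \<Rightarrow> bool" where
  "determines_alignment B S \<longleftrightarrow>
     (\<forall>f\<in>L2_functions. \<forall>h\<in>L2_functions. \<forall>g. is_alignment f h g \<longrightarrow> (g \<in> B \<longleftrightarrow> (f, h) \<in> S))"

text \<open>
  The unique minimizer lies in \<open>K\<close> iff the infimum of the cost over \<open>K\<close> is at most its infimum over all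
  rotations: by compactness the former is attained, and the point where it is attained must then be
  the minimizer. By continuity both infima may be taken over countable dense sets of rotations, which
  makes the comparison a countable combination of measurable conditions.
\<close>
lemma alignment_in_compact:
  assumes K: "compact K" "K \<subseteq> SO2"
  shows "\<exists>S\<in>sets (L2_borel \<Otimes>\<^sub>M L2_borel). determines_alignment K S"
proof -
  obtain D where D: "countable D" "D \<subseteq> SO2" "SO2 \<subseteq> closure D"
    by (rule separable)
  obtain D' where D': "countable D'" "D' \<subseteq> K" "K \<subseteq> closure D'"
    by (rule separable)
  let ?S = "{w \<in> space (L2_borel \<Otimes>\<^sub>M L2_borel). \<forall>d\<in>D. \<forall>m::nat. \<exists>d'\<in>D'.
     alignment_cost (fst w) (snd w) d' < alignment_cost (fst w) (snd w) d + 1 / Suc m}"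
  have "?S \<in> sets (L2_borel \<Otimes>\<^sub>M L2_borel)"
  proof (intro sets.sets_Collect_countable_All' sets.sets_Collect_countable_All sets.sets_Collect_countable_Ex' D(1) D'(1))
    fix d d' and m :: nat assume "d \<in> D" "d' \<in> D'"
    then have [measurable]: "(\<lambda>w. alignment_cost (fst w) (snd w) d) \<in> borel_measurable (L2_borel \<Otimes>\<^sub>M L2_borel)"
      "(\<lambda>w. alignment_cost (fst w) (snd w) d') \<in> borel_measurable (L2_borel \<Otimes>\<^sub>M L2_borel)"
      using D(2) D'(2) K(2) by (auto intro!: alignment_cost_measurable)
    show "{w \<in> space (L2_borel \<Otimes>\<^sub>M L2_borel).
        alignment_cost (fst w) (snd w) d' < alignment_cost (fst w) (snd w) d + 1 / Suc m} \<in> sets (L2_borel \<Otimes>\<^sub>M L2_borel)"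
      by measurable
  qed
  moreover have "determines_alignment K ?S"
    unfolding determines_alignment_def
  proof (intro ballI allI impI)
    fix f h g assume f: "f \<in> L2_functions" and h: "h \<in> L2_functions" and al: "is_alignment f h g"
    have g: "g \<in> SO2" and less: "\<And>x. x \<in> SO2 \<Longrightarrow> x \<noteq> g \<Longrightarrow> alignment_cost f h g < alignment_cost f h x"
      using al by (auto simp: is_alignment_iff)
    have le: "alignment_cost f h g \<le> alignment_cost f h x" if "x \<in> SO2" for x
      using less[OF that] by (cases "x = g") auto
    have cont: "continuous_on SO2 (alignment_cost f h)"
      by (rule alignment_cost_continuous[OF f h])
    have "g \<in> K \<longleftrightarrow> (\<forall>d\<in>D. \<forall>m::nat. \<exists>d'\<in>D'. alignment_cost f h d' < alignment_cost f h d + 1 / Suc m)"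
      (is "_ \<longleftrightarrow> ?C")
    proof
      assume gK: "g \<in> K"
      show ?C
      proof (intro ballI allI)
        fix d m assume "d \<in> D"
        then have "alignment_cost f h g \<le> alignment_cost f h d"
          using D(2) by (intro le) auto
        also have "\<dots> < alignment_cost f h d + 1 / Suc m" by simp
        finally have "alignment_cost f h g < alignment_cost f h d + 1 / Suc m" .
        moreover obtain \<gamma> where \<gamma>: "\<And>n. \<gamma> n \<in> D'" "\<gamma> \<longlonglongrightarrow> g"
          using subsetD[OF D'(3) gK] unfolding closure_sequential by blast
        moreover have "(\<lambda>n. alignment_cost f h (\<gamma> n)) \<longlonglongrightarrow> alignment_cost f h g"
          using cont \<gamma> g D'(2) K(2) unfolding continuous_on_sequentially comp_def by blast
        ultimately have "\<forall>\<^sub>F n in sequentially. alignment_cost f h (\<gamma> n) < alignment_cost f h d + 1 / Suc m"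
          by (intro order_tendstoD(2))
        then obtain n where "alignment_cost f h (\<gamma> n) < alignment_cost f h d + 1 / Suc m"
          by (auto simp: eventually_sequentially)
        with \<gamma>(1) show "\<exists>d'\<in>D'. alignment_cost f h d' < alignment_cost f h d + 1 / Suc m" by blast
      qed
    next
      assume C: ?C
      \<comment> \<open>nonemptiness of \<open>K\<close>: the condition is not vacuous, since \<open>D\<close> is dense in a nonempty group\<close>
      have "mat 1 \<in> SO2" using SO2_mult[OF g SO2_transpose[OF g]] SO2_transpose_inverse[OF g] by simp
      then obtain d0 where "d0 \<in> D" using D(3) by force
      with C have "K \<noteq> {}" using D'(2) by fastforce
      then obtain k where k: "k \<in> K" "\<And>x. x \<in> K \<Longrightarrow> alignment_cost f h k \<le> alignment_cost f h x"
        using continuous_attains_inf[OF K(1) _ continuous_on_subset[OF cont K(2)]] by blast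
      have le_D: "alignment_cost f h k \<le> alignment_cost f h d" if d: "d \<in> D" for d
      proof (rule field_le_epsilon)
        fix e :: real assume "0 < e"
        then obtain m where m: "inverse (real (Suc m)) < e" using reals_Archimedean by blast
        obtain d' where "d' \<in> D'" "alignment_cost f h d' < alignment_cost f h d + 1 / Suc m"
          using C d by blast
        with m k(2)[of d'] D'(2) show "alignment_cost f h k \<le> alignment_cost f h d + e"
          by (auto simp: inverse_eq_divide)
      qed
      have "alignment_cost f h k \<le> alignment_cost f h x" if x: "x \<in> SO2" for x
      proof -
        obtain \<gamma> where \<gamma>: "\<And>n. \<gamma> n \<in> D" "\<gamma> \<longlonglongrightarrow> x"
          using subsetD[OF D(3) x] unfolding closure_sequential by blast
        have "(\<lambda>n. alignment_cost f h (\<gamma> n)) \<longlonglongrightarrow> alignment_cost f h x"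
          using cont \<gamma> x D(2) unfolding continuous_on_sequentially comp_def by blast
        then show ?thesis
          by (rule LIMSEQ_le_const) (use le_D \<gamma> in blast)
      qed
      from this[OF g] less[of k] k(1) K(2) show "g \<in> K"
        by (cases "k = g") auto
    qed
    then show "g \<in> K \<longleftrightarrow> (f, h) \<in> ?S"
      by (simp add: space_pair_measure f h)
  qed
  ultimately show ?thesis by blast
qed

lemma alignment_in_Borel:
  assumes "B \<in> sets borel"
  shows "\<exists>S\<in>sets (L2_borel \<Otimes>\<^sub>M L2_borel). determines_alignment B S"
proof -
  have "B \<in> sigma_sets UNIV (Collect closed)"
    using assms by (simp add: borel_eq_closed)
  then show ?thesis
  proof induction
    case (Basic K)
    then have "compact (SO2 \<inter> K)"
      by (intro compact_Int_closed compact_SO2) simp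
    then obtain S where "S \<in> sets (L2_borel \<Otimes>\<^sub>M L2_borel)" "determines_alignment (SO2 \<inter> K) S"
      using alignment_in_compact[of "SO2 \<inter> K"] by auto
    then show ?case
      by (intro bexI[of _ S]) (auto simp: determines_alignment_def is_alignment_iff)
  next
    case Empty
    show ?case by (intro bexI[of _ "{}"]) (auto simp: determines_alignment_def)
  next
    case (Compl B)
    then obtain S where S: "S \<in> sets (L2_borel \<Otimes>\<^sub>M L2_borel)" "determines_alignment B S" by blast
    show ?case
    proof (rule bexI[OF _ sets.compl_sets[OF S(1)]])
      show "determines_alignment (UNIV - B) (space (L2_borel \<Otimes>\<^sub>M L2_borel) - S)"
        using S(2) by (auto simp: determines_alignment_def space_pair_measure)
    qed
  next
    case (Union B)
    then obtain S where "\<And>i. S i \<in> sets (L2_borel \<Otimes>\<^sub>M L2_borel)" "\<And>i. determines_alignment (B i) (S i)"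
      by metis
    then show ?case
      by (intro bexI[of _ "\<Union>i::nat. S i"]) (auto simp: determines_alignment_def)
  qed
qed

section \<open>Independence of alignments\<close>

context prob_space
begin

lemma indep_var_hetI:
  assumes [measurable]: "random_variable N X" "random_variable K Y"
    and prod: "\<And>A B. A \<in> sets N \<Longrightarrow> B \<in> sets K \<Longrightarrow>
      prob {\<omega> \<in> space M. X \<omega> \<in> A \<and> Y \<omega> \<in> B}
        = prob {\<omega> \<in> space M. X \<omega> \<in> A} * prob {\<omega> \<in> space M. Y \<omega> \<in> B}"
  shows "indep_var_het N X K Y"
  unfolding indep_var_het_def
proof (intro conjI indep_setI)
  fix a b assume "a \<in> {X -` A \<inter> space M |A. A \<in> sets N}" "b \<in> {Y -` B \<inter> space M |B. B \<in> sets K}"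
  then obtain A B where "A \<in> sets N" "B \<in> sets K" "a = {\<omega> \<in> space M. X \<omega> \<in> A}" "b = {\<omega> \<in> space M. Y \<omega> \<in> B}"
    by (auto simp: vimage_def Int_def conj_commute)
  moreover have "{\<omega> \<in> space M. X \<omega> \<in> A} \<inter> {\<omega> \<in> space M. Y \<omega> \<in> B}
      = {\<omega> \<in> space M. X \<omega> \<in> A \<and> Y \<omega> \<in> B}" by auto
  ultimately show "prob (a \<inter> b) = prob a * prob b"
    using prod by simp
qed auto

lemma indep_var_hetD:
  assumes "indep_var_het N X K Y" "A \<in> sets N" "B \<in> sets K"
  shows "prob {\<omega> \<in> space M. X \<omega> \<in> A \<and> Y \<omega> \<in> B}
    = prob {\<omega> \<in> space M. X \<omega> \<in> A} * prob {\<omega> \<in> space M. Y \<omega> \<in> B}"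
proof -
  have "prob ((X -` A \<inter> space M) \<inter> (Y -` B \<inter> space M)) = prob (X -` A \<inter> space M) * prob (Y -` B \<inter> space M)"
    using assms by (intro indep_setD[of "{X -` A \<inter> space M |A. A \<in> sets N}" "{Y -` B \<inter> space M |B. B \<in> sets K}"])
      (auto simp: indep_var_het_def)
  moreover have "(X -` A \<inter> space M) \<inter> (Y -` B \<inter> space M) = {\<omega> \<in> space M. X \<omega> \<in> A \<and> Y \<omega> \<in> B}" by auto
  ultimately show ?thesis by (simp add: vimage_def Int_def conj_commute)
qed

lemma indep_var_het_sym:
  assumes "indep_var_het N X K Y" shows "indep_var_het K Y N X"
  using assms by (intro indep_var_hetI)
    (auto simp: indep_var_het_def conj_commute mult.commute dest: indep_var_hetD[OF assms])

lemma indep_var_iff_het: "indep_var N X K Y \<longleftrightarrow> indep_var_het N X K Y"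
proof
  assume ind: "indep_var N X K Y"
  show "indep_var_het N X K Y"
    using ind by (auto simp: indep_var_eq indep_var_het_def indep_sets2_eq)
next
  assume ind: "indep_var_het N X K Y"
  have stable: "Int_stable {f -` A \<inter> space M |A. A \<in> sets L}" for f :: "'a \<Rightarrow> 'c" and L
  proof (rule Int_stableI)
    fix a b assume "a \<in> {f -` A \<inter> space M |A. A \<in> sets L}" "b \<in> {f -` A \<inter> space M |A. A \<in> sets L}"
    then obtain A B where AB: "A \<in> sets L" "B \<in> sets L" "a = f -` A \<inter> space M" "b = f -` B \<inter> space M" by blast
    then have "a \<inter> b = f -` (A \<inter> B) \<inter> space M" by auto
    with AB show "a \<inter> b \<in> {f -` A \<inter> space M |A. A \<in> sets L}" by blast
  qed
  show "indep_var N X K Y"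
    unfolding indep_var_eq
    using ind by (intro conjI indep_set_sigma_sets stable) (auto simp: indep_var_het_def)
qed

lemma indep_var_het_compose:
  assumes ind: "indep_var_het N X K Y" and [measurable]: "h \<in> K \<rightarrow>\<^sub>M L"
  shows "indep_var_het N X L (\<lambda>\<omega>. h (Y \<omega>))"
proof -
  have [measurable]: "random_variable N X" and Y [measurable]: "random_variable K Y"
    using ind by (auto simp: indep_var_het_def)
  show ?thesis
  proof (rule indep_var_hetI)
    fix A B assume A: "A \<in> sets N" and B: "B \<in> sets L"
    have "h -` B \<inter> space K \<in> sets K" using B by measurable
    from indep_var_hetD[OF ind A this]
    show "prob {\<omega> \<in> space M. X \<omega> \<in> A \<and> h (Y \<omega>) \<in> B}
        = prob {\<omega> \<in> space M. X \<omega> \<in> A} * prob {\<omega> \<in> space M. h (Y \<omega>) \<in> B}"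
      using measurable_space[OF Y] by (simp cong: conj_cong)
  qed measurable
qed

text \<open>
  The form in which independence is used: the joint law depends on the two marginals only, so it does
  not change when \<open>Y\<close> is replaced by an independent variable with the same law.
\<close>
lemma indep_var_het_joint_law:
  assumes ind: "indep_var_het N X K Y"
  shows "distr M (N \<Otimes>\<^sub>M K) (\<lambda>\<omega>. (X \<omega>, Y \<omega>)) = distr M N X \<Otimes>\<^sub>M distr M K Y"
proof -
  have [measurable]: "random_variable N X" "random_variable K Y"
    using ind by (auto simp: indep_var_het_def)
  interpret X: prob_space "distr M N X" by (rule prob_space_distr) simp
  interpret Y: prob_space "distr M K Y" by (rule prob_space_distr) simp
  have "distr M N X \<Otimes>\<^sub>M distr M K Y = distr M (N \<Otimes>\<^sub>M K) (\<lambda>\<omega>. (X \<omega>, Y \<omega>))"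
  proof (rule pair_measure_eqI)
    fix A B assume "A \<in> sets (distr M N X)" "B \<in> sets (distr M K Y)"
    then have [measurable]: "A \<in> sets N" "B \<in> sets K" by auto
    have "emeasure (distr M (N \<Otimes>\<^sub>M K) (\<lambda>\<omega>. (X \<omega>, Y \<omega>))) (A \<times> B) = prob {\<omega> \<in> space M. X \<omega> \<in> A \<and> Y \<omega> \<in> B}"
      by (subst emeasure_distr) (auto simp: emeasure_eq_measure intro!: arg_cong[where f=prob])
    also have "\<dots> = prob {\<omega> \<in> space M. X \<omega> \<in> A} * prob {\<omega> \<in> space M. Y \<omega> \<in> B}"
      using indep_var_hetD[OF ind] by simp
    also have "\<dots> = emeasure (distr M N X) A * emeasure (distr M K Y) B"
      by (simp add: emeasure_distr emeasure_eq_measure ennreal_mult vimage_def Int_def conj_commute)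
    finally show "emeasure (distr M N X) A * emeasure (distr M K Y) B
        = emeasure (distr M (N \<Otimes>\<^sub>M K) (\<lambda>\<omega>. (X \<omega>, Y \<omega>))) (A \<times> B)" ..
  qed (auto intro: X.sigma_finite_measure Y.sigma_finite_measure X.sigma_finite_measure_axioms Y.sigma_finite_measure_axioms)
  then show ?thesis ..
qed

text \<open>
  Uniqueness of Haar measure applied to the law of \<open>\<gamma>\<close> on the event \<open>E\<close>, a measure of total mass
  \<open>prob E\<close>.
\<close>
lemma uniform_of_shift_invariant:
  assumes \<gamma> [measurable]: "random_variable SO2_borel \<gamma>" and E: "E \<in> events"
    and inv: "\<And>k B. k \<in> SO2 \<Longrightarrow> B \<in> sets SO2_borel \<Longrightarrow>
      prob {\<omega> \<in> E. k ** \<gamma> \<omega> \<in> B} = prob {\<omega> \<in> E. \<gamma> \<omega> \<in> B}"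
    and B: "B \<in> sets SO2_borel"
  shows "prob {\<omega> \<in> E. \<gamma> \<omega> \<in> B} = measure uniform_SO2 B * prob E"
proof -
  interpret U: prob_space uniform_SO2 by (rule uniform_SO2_prob_space)
  define \<nu> where "\<nu> = distr (restrict_space M E) SO2_borel \<gamma>"
  have E': "E \<inter> space M \<in> events" "E \<subseteq> space M" using E sets.sets_into_space by auto
  have \<gamma>E: "\<gamma> \<in> restrict_space M E \<rightarrow>\<^sub>M SO2_borel" by (rule measurable_restrict_space1) fact
  have \<nu>: "emeasure \<nu> A = prob {\<omega> \<in> E. \<gamma> \<omega> \<in> A}" if "A \<in> sets SO2_borel" for A
  proof -
    have "emeasure \<nu> A = emeasure (restrict_space M E) {\<omega> \<in> E. \<gamma> \<omega> \<in> A}"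
      unfolding \<nu>_def using that E'
      by (subst emeasure_distr[OF \<gamma>E]) (auto simp: space_restrict_space intro!: arg_cong2[where f=emeasure])
    also have "\<dots> = emeasure M {\<omega> \<in> E. \<gamma> \<omega> \<in> A}"
      by (rule emeasure_restrict_space) (use E' in auto)
    finally show ?thesis by (simp add: emeasure_eq_measure)
  qed
  have range: "\<gamma> \<omega> \<in> SO2" if "\<omega> \<in> E" for \<omega>
    using measurable_space[OF \<gamma>] that E' by auto
  have SO2: "SO2 \<in> sets SO2_borel" using sets.top[of SO2_borel] by simp
  have "emeasure \<nu> B = emeasure uniform_SO2 B * emeasure \<nu> SO2"
  proof (rule uniform_SO2_unique[OF _ _ _ B])
    have "finite_measure (restrict_space M E)"
      by (rule finite_measure_restrict_space[OF _ E]) unfold_locales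
    then show "finite_measure \<nu>"
      unfolding \<nu>_def by (rule finite_measure.finite_measure_distr[OF _ \<gamma>E])
    show "sets \<nu> = sets SO2_borel" by (simp add: \<nu>_def)
    fix k A assume kA: "k \<in> SO2" "A \<in> sets SO2_borel"
    have "{\<omega> \<in> E. \<gamma> \<omega> \<in> {x \<in> SO2. k ** x \<in> A}} = {\<omega> \<in> E. k ** \<gamma> \<omega> \<in> A}"
      using range by auto
    then show "emeasure \<nu> {x \<in> SO2. k ** x \<in> A} = emeasure \<nu> A"
      using inv[OF kA] by (simp add: \<nu>[OF SO2_shift_measurable[OF kA(2)]] \<nu>[OF kA(2)])
  qed
  moreover have "{\<omega> \<in> E. \<gamma> \<omega> \<in> SO2} = E" using range by auto
  ultimately have "ennreal (prob {\<omega> \<in> E. \<gamma> \<omega> \<in> B}) = ennreal (measure uniform_SO2 B) * ennreal (prob E)"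
    by (simp add: \<nu>[OF B] \<nu>[OF SO2] U.emeasure_eq_measure)
  then show ?thesis
    by (simp flip: ennreal_mult)
qed

text \<open>
  Conditionally on \<open>X\<close>, the alignment is uniform. By equivariance \<open>k \<gamma>\<close> aligns \<open>W\<close> rotated by the
  inverse of \<open>k\<close>, so both sides of the invariance condition are the probability of one and the same
  set \<open>A\<close> of pairs, under the laws of \<open>X\<close> with the rotated \<open>W\<close> and of \<open>X\<close> with \<open>W\<close>. These laws agree.
\<close>
lemma alignment_uniform_given:
  assumes ind: "indep_var_het N X L2_borel W" and invW: "rotation_invariant W"
    and \<Phi> [measurable]: "\<Phi> \<in> N \<rightarrow>\<^sub>M L2_borel"
    and \<gamma> [measurable]: "random_variable SO2_borel \<gamma>"
    and al: "AE \<omega> in M. is_alignment (\<Phi> (X \<omega>)) (W \<omega>) (\<gamma> \<omega>)"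
    and B: "B \<in> sets SO2_borel" and C: "C \<in> sets N"
  shows "prob {\<omega> \<in> space M. \<gamma> \<omega> \<in> B \<and> X \<omega> \<in> C} = measure uniform_SO2 B * prob {\<omega> \<in> space M. X \<omega> \<in> C}"
proof -
  have X [measurable]: "random_variable N X" and W [measurable]: "random_variable L2_borel W"
    using ind by (auto simp: indep_var_het_def)
  let ?E = "{\<omega> \<in> space M. X \<omega> \<in> C}"
  have "prob {\<omega> \<in> ?E. \<gamma> \<omega> \<in> B} = measure uniform_SO2 B * prob ?E"
  proof (rule uniform_of_shift_invariant[OF \<gamma> _ _ B])
    show "?E \<in> events" using C by measurable
    then have E_event: "{\<omega> \<in> ?E. \<gamma> \<omega> \<in> B} \<in> events" if "B \<in> sets SO2_borel" for B
      using that by measurable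
    fix k B assume k: "k \<in> SO2" and B: "B \<in> sets SO2_borel"
    have "{\<omega> \<in> ?E. k ** \<gamma> \<omega> \<in> B} = {\<omega> \<in> ?E. \<gamma> \<omega> \<in> {x \<in> SO2. k ** x \<in> B}}"
      using measurable_space[OF \<gamma>] by auto
    then have kE_event: "{\<omega> \<in> ?E. k ** \<gamma> \<omega> \<in> B} \<in> events"
      using E_event[OF SO2_shift_measurable[OF B]] by simp
    let ?W' = "\<lambda>\<omega>. SO2_act (transpose k) (W \<omega>)"
    have act [measurable]: "SO2_act (transpose k) \<in> L2_borel \<rightarrow>\<^sub>M L2_borel"
      by (intro SO2_act_measurable SO2_transpose k)
    obtain S where S [measurable]: "S \<in> sets (L2_borel \<Otimes>\<^sub>M L2_borel)" and det: "determines_alignment B S"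
      using alignment_in_Borel B by (auto simp: sets_SO2_borel)
    define A where "A = {p \<in> space (N \<Otimes>\<^sub>M L2_borel). fst p \<in> C \<and> (\<Phi> (fst p), snd p) \<in> S}"
    have A [measurable]: "A \<in> sets (N \<Otimes>\<^sub>M L2_borel)"
      unfolding A_def using C by measurable
    have "prob {\<omega> \<in> ?E. k ** \<gamma> \<omega> \<in> B} = prob {\<omega> \<in> space M. (X \<omega>, ?W' \<omega>) \<in> A}"
    proof (rule finite_measure_eq_AE)
      show "AE \<omega> in M. \<omega> \<in> {\<omega> \<in> ?E. k ** \<gamma> \<omega> \<in> B} \<longleftrightarrow> \<omega> \<in> {\<omega> \<in> space M. (X \<omega>, ?W' \<omega>) \<in> A}"
        using al AE_space
      proof eventually_elim
        case (elim \<omega>)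
        have "is_alignment (\<Phi> (X \<omega>)) (?W' \<omega>) (k ** \<gamma> \<omega>)"
          using is_alignment_SO2_act[OF elim(1) SO2_transpose[OF k]] by simp
        moreover have "X \<omega> \<in> space N" "\<Phi> (X \<omega>) \<in> L2_functions" "?W' \<omega> \<in> L2_functions"
          using measurable_space[OF X elim(2)] measurable_space[OF \<Phi>, of "X \<omega>"]
            measurable_space[OF act, of "W \<omega>"] measurable_space[OF W elim(2)] by auto
        ultimately show ?case
          using det elim(2) by (auto simp: determines_alignment_def A_def space_pair_measure)
      qed
    qed (use kE_event in measurable)
    also have "\<dots> = measure (distr M (N \<Otimes>\<^sub>M L2_borel) (\<lambda>\<omega>. (X \<omega>, ?W' \<omega>))) A"
      by (subst measure_distr) (auto intro!: arg_cong[where f=prob])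
    also have "distr M (N \<Otimes>\<^sub>M L2_borel) (\<lambda>\<omega>. (X \<omega>, ?W' \<omega>)) = distr M N X \<Otimes>\<^sub>M distr M L2_borel ?W'"
      by (intro indep_var_het_joint_law indep_var_het_compose[OF ind] act)
    also have "distr M L2_borel ?W' = distr M L2_borel W"
      using invW SO2_transpose[OF k] by (auto simp: rotation_invariant_def)
    also have "distr M N X \<Otimes>\<^sub>M distr M L2_borel W = distr M (N \<Otimes>\<^sub>M L2_borel) (\<lambda>\<omega>. (X \<omega>, W \<omega>))"
      by (rule indep_var_het_joint_law[OF ind, symmetric])
    also have "measure \<dots> A = prob {\<omega> \<in> space M. (X \<omega>, W \<omega>) \<in> A}"
      by (subst measure_distr) (auto intro!: arg_cong[where f=prob])
    also have "\<dots> = prob {\<omega> \<in> ?E. \<gamma> \<omega> \<in> B}"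
    proof (rule finite_measure_eq_AE)
      show "AE \<omega> in M. \<omega> \<in> {\<omega> \<in> space M. (X \<omega>, W \<omega>) \<in> A} \<longleftrightarrow> \<omega> \<in> {\<omega> \<in> ?E. \<gamma> \<omega> \<in> B}"
        using al AE_space
      proof eventually_elim
        case (elim \<omega>)
        have "X \<omega> \<in> space N" "\<Phi> (X \<omega>) \<in> L2_functions" "W \<omega> \<in> L2_functions"
          using measurable_space[OF X elim(2)] measurable_space[OF \<Phi>, of "X \<omega>"]
            measurable_space[OF W elim(2)] by auto
        then show ?case
          using det elim by (auto simp: determines_alignment_def A_def space_pair_measure)
      qed
    qed (use E_event[OF B] in measurable)
    finally show "prob {\<omega> \<in> ?E. k ** \<gamma> \<omega> \<in> B} = prob {\<omega> \<in> ?E. \<gamma> \<omega> \<in> B}" .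
  qed
  moreover have "{\<omega> \<in> ?E. \<gamma> \<omega> \<in> B} = {\<omega> \<in> space M. \<gamma> \<omega> \<in> B \<and> X \<omega> \<in> C}" by auto
  ultimately show ?thesis by simp
qed

lemma alignment_indep_uniform:
  assumes ind: "indep_var_het N X L2_borel W" and invW: "rotation_invariant W"
    and \<Phi>: "\<Phi> \<in> N \<rightarrow>\<^sub>M L2_borel"
    and \<gamma> [measurable]: "random_variable SO2_borel \<gamma>"
    and al: "AE \<omega> in M. is_alignment (\<Phi> (X \<omega>)) (W \<omega>) (\<gamma> \<omega>)"
  shows "indep_var_het SO2_borel \<gamma> N X" and "distr M SO2_borel \<gamma> = uniform_SO2"
proof -
  have X [measurable]: "random_variable N X"
    using ind by (auto simp: indep_var_het_def)
  note joint = alignment_uniform_given[OF ind invW \<Phi> \<gamma> al]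
  have marginal: "prob {\<omega> \<in> space M. \<gamma> \<omega> \<in> B} = measure uniform_SO2 B" if B: "B \<in> sets SO2_borel" for B
    using joint[OF B sets.top] measurable_space[OF X] by (simp add: prob_space cong: conj_cong)
  show "indep_var_het SO2_borel \<gamma> N X"
    by (rule indep_var_hetI) (simp_all add: joint marginal X)
  interpret U: prob_space uniform_SO2 by (rule uniform_SO2_prob_space)
  show "distr M SO2_borel \<gamma> = uniform_SO2"
  proof (rule measure_eqI)
    show "sets (distr M SO2_borel \<gamma>) = sets uniform_SO2"
      by (simp add: uniform_SO2_def)
    fix B assume "B \<in> sets (distr M SO2_borel \<gamma>)"
    then show "emeasure (distr M SO2_borel \<gamma>) B = emeasure uniform_SO2 B"
      using marginal[of B]
      by (simp add: emeasure_distr emeasure_eq_measure U.emeasure_eq_measure vimage_def Int_def conj_commute)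
  qed
qed

lemma indep_vars_split_off:
  assumes ind: "indep_vars N Z I" and l: "l \<in> I"
  shows "indep_var_het (PiM (I - {l}) N) (\<lambda>\<omega>. restrict (\<lambda>i. Z i \<omega>) (I - {l})) (N l) (Z l)"
proof -
  have "indep_var_het (PiM (I - {l}) N) (\<lambda>\<omega>. restrict (\<lambda>i. Z i \<omega>) (I - {l}))
      (PiM {l} N) (\<lambda>\<omega>. restrict (\<lambda>i. Z i \<omega>) {l})"
    unfolding indep_var_iff_het[symmetric] using l by (intro indep_var_restrict[OF ind]) auto
  from indep_var_het_compose[OF this measurable_component_singleton[of l "{l}" N]]
  show ?thesis by simp
qed

text \<open>
  Here \<open>X\<close> is the family of all functions except \<open>Z l\<close>. The alignments \<open>\<delta> k\<close> between members of this
  family are not functions of \<open>X\<close>, but events about them agree almost surely with events about \<open>X\<close>.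
  The index set \<open>K\<close> may be empty, which gives the law of \<open>\<gamma>\<close> itself.
\<close>
lemma alignment_uniform_given_others:
  assumes ind: "indep_vars (\<lambda>_. L2_borel) Z I" and l: "l \<in> I" "rotation_invariant (Z l)"
    and j: "j \<in> I - {l}"
    and \<gamma>: "random_variable SO2_borel \<gamma>" "AE \<omega> in M. is_alignment (Z j \<omega>) (Z l \<omega>) (\<gamma> \<omega>)"
    and B: "B \<in> sets SO2_borel"
    and K: "finite K"
    and ab: "\<And>k. k \<in> K \<Longrightarrow> a k \<in> I - {l} \<and> b k \<in> I - {l}"
    and \<delta>: "\<And>k. k \<in> K \<Longrightarrow> random_variable SO2_borel (\<delta> k)"
    and al: "\<And>k. k \<in> K \<Longrightarrow> AE \<omega> in M. is_alignment (Z (a k) \<omega>) (Z (b k) \<omega>) (\<delta> k \<omega>)"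
    and D: "\<And>k. k \<in> K \<Longrightarrow> D k \<in> sets SO2_borel"
  shows "prob {\<omega> \<in> space M. \<gamma> \<omega> \<in> B \<and> (\<forall>k\<in>K. \<delta> k \<omega> \<in> D k)}
    = measure uniform_SO2 B * prob {\<omega> \<in> space M. \<forall>k\<in>K. \<delta> k \<omega> \<in> D k}"
proof -
  let ?N = "PiM (I - {l}) (\<lambda>_. L2_borel)"
  let ?X = "\<lambda>\<omega>. restrict (\<lambda>i. Z i \<omega>) (I - {l})"
  note split = indep_vars_split_off[OF ind l(1)]
  have X [measurable]: "random_variable ?N ?X"
    using split by (auto simp: indep_var_het_def)
  have comp [measurable]: "(\<lambda>x. x i) \<in> ?N \<rightarrow>\<^sub>M L2_borel" if "i \<in> I - {l}" for i
    using that by (rule measurable_component_singleton)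
  have "\<forall>k\<in>K. \<exists>S\<in>sets (L2_borel \<Otimes>\<^sub>M L2_borel). determines_alignment (D k) S"
    using D by (auto simp: sets_SO2_borel intro!: alignment_in_Borel)
  then obtain S where S: "\<And>k. k \<in> K \<Longrightarrow> S k \<in> sets (L2_borel \<Otimes>\<^sub>M L2_borel)"
    "\<And>k. k \<in> K \<Longrightarrow> determines_alignment (D k) (S k)"
    by metis
  define C where "C = {x \<in> space ?N. \<forall>k\<in>K. (x (a k), x (b k)) \<in> S k}"
  have C [measurable]: "C \<in> sets ?N"
    unfolding C_def
  proof (rule sets.sets_Collect_finite_All[OF _ K])
    fix k assume k: "k \<in> K"
    have "(\<lambda>x. (x (a k), x (b k))) \<in> ?N \<rightarrow>\<^sub>M L2_borel \<Otimes>\<^sub>M L2_borel"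
      using ab[OF k] by (intro measurable_Pair comp) auto
    from measurable_sets[OF this S(1)[OF k]]
    show "{x \<in> space ?N. (x (a k), x (b k)) \<in> S k} \<in> sets ?N"
      by (simp add: vimage_def Int_def conj_commute)
  qed
  have "AE \<omega> in M. \<forall>k\<in>K. is_alignment (Z (a k) \<omega>) (Z (b k) \<omega>) (\<delta> k \<omega>)"
    using K al by (simp add: AE_finite_all)
  then have det: "AE \<omega> in M. (\<forall>k\<in>K. \<delta> k \<omega> \<in> D k) \<longleftrightarrow> ?X \<omega> \<in> C"
    using AE_space
  proof eventually_elim
    case (elim \<omega>)
    have X\<omega>: "?X \<omega> \<in> space ?N" by (rule measurable_space[OF X elim(2)])
    have "\<delta> k \<omega> \<in> D k \<longleftrightarrow> (Z (a k) \<omega>, Z (b k) \<omega>) \<in> S k" if k: "k \<in> K" for k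
    proof -
      have "Z (a k) \<omega> \<in> L2_functions" "Z (b k) \<omega> \<in> L2_functions"
        using measurable_space[OF comp X\<omega>, of "a k"] measurable_space[OF comp X\<omega>, of "b k"] ab[OF k] by auto
      then show ?thesis
        using S(2)[OF k] elim(1) k by (auto simp: determines_alignment_def)
    qed
    then show ?case
      using X\<omega> ab by (auto simp: C_def)
  qed
  have [measurable]: "{\<omega> \<in> space M. \<forall>k\<in>K. \<delta> k \<omega> \<in> D k} \<in> events"
  proof (rule sets.sets_Collect_finite_All[OF _ K])
    fix k assume k: "k \<in> K"
    from measurable_sets[OF \<delta>[OF k] D[OF k]] show "{\<omega> \<in> space M. \<delta> k \<omega> \<in> D k} \<in> events"
      by (simp add: vimage_def Int_def conj_commute)
  qed
  have [measurable]: "{\<omega> \<in> space M. \<gamma> \<omega> \<in> B} \<in> events"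
    using \<gamma>(1) B by measurable
  have "prob {\<omega> \<in> space M. \<gamma> \<omega> \<in> B \<and> (\<forall>k\<in>K. \<delta> k \<omega> \<in> D k)} = prob {\<omega> \<in> space M. \<gamma> \<omega> \<in> B \<and> ?X \<omega> \<in> C}"
    using det \<gamma>(1) B by (intro prob_eq_AE) (auto elim: eventually_mono)
  also have "\<dots> = measure uniform_SO2 B * prob {\<omega> \<in> space M. ?X \<omega> \<in> C}"
    using \<gamma>(2) j by (intro alignment_uniform_given[OF split l(2) comp[OF j] \<gamma>(1) _ B C]) auto
  also have "prob {\<omega> \<in> space M. ?X \<omega> \<in> C} = prob {\<omega> \<in> space M. \<forall>k\<in>K. \<delta> k \<omega> \<in> D k}"
    using det by (intro prob_eq_AE) (auto elim: eventually_mono)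
  finally show ?thesis .
qed

lemma alignments_indep_var:
  assumes ind: "indep_vars (\<lambda>_. L2_borel) Z I" and l: "l \<in> I" "rotation_invariant (Z l)"
    and j: "j \<in> I - {l}" and ab: "a \<in> I - {l}" "b \<in> I - {l}"
    and \<gamma>: "random_variable SO2_borel \<gamma>" "AE \<omega> in M. is_alignment (Z j \<omega>) (Z l \<omega>) (\<gamma> \<omega>)"
    and \<delta>: "random_variable SO2_borel \<delta>" "AE \<omega> in M. is_alignment (Z a \<omega>) (Z b \<omega>) (\<delta> \<omega>)"
  shows "indep_var SO2_borel \<delta> SO2_borel \<gamma>"
proof -
  have "indep_var_het SO2_borel \<gamma> SO2_borel \<delta>"
  proof (rule indep_var_hetI)
    fix B D assume B: "B \<in> sets SO2_borel" and D: "D \<in> sets SO2_borel"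
    note given = alignment_uniform_given_others[OF ind l j \<gamma> B]
    have "prob {\<omega> \<in> space M. \<gamma> \<omega> \<in> B} = measure uniform_SO2 B"
      using given[of "{}" "\<lambda>_. a" "\<lambda>_. b" "\<lambda>_. \<delta>" "\<lambda>_. D"] by (simp add: prob_space)
    then show "prob {\<omega> \<in> space M. \<gamma> \<omega> \<in> B \<and> \<delta> \<omega> \<in> D}
        = prob {\<omega> \<in> space M. \<gamma> \<omega> \<in> B} * prob {\<omega> \<in> space M. \<delta> \<omega> \<in> D}"
      using given[of "{()}" "\<lambda>_. a" "\<lambda>_. b" "\<lambda>_. \<delta>" "\<lambda>_. D"] ab \<delta> D by simp
  qed (use \<gamma> \<delta> in auto)
  then show ?thesis
    using indep_var_het_sym indep_var_iff_het by blast
qed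

text \<open>
  Joint probabilities factor by induction on the index set: adding \<open>l\<close> adds an alignment that involves
  \<open>Z l\<close>, while the alignments of \<open>Z i\<close> with the earlier functions do not.
\<close>
lemma star_alignments_indep_vars:
  assumes ind: "indep_vars (\<lambda>_. L2_borel) Z I" and fin: "finite I" and i: "i \<in> I"
    and inv: "\<And>l. l \<in> I \<Longrightarrow> rotation_invariant (Z l)"
    and \<gamma>: "\<And>j. j \<in> I - {i} \<Longrightarrow> random_variable SO2_borel (\<gamma> j)"
    and al: "\<And>j. j \<in> I - {i} \<Longrightarrow> AE \<omega> in M. is_alignment (Z i \<omega>) (Z j \<omega>) (\<gamma> j \<omega>)"
  shows "indep_vars (\<lambda>_. SO2_borel) \<gamma> (I - {i})"
proof -
  have prod: "prob {\<omega> \<in> space M. \<forall>j\<in>J. \<gamma> j \<omega> \<in> A j} = (\<Prod>j\<in>J. measure uniform_SO2 (A j))"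
    if "finite J" "J \<subseteq> I - {i}" "\<And>j. j \<in> J \<Longrightarrow> A j \<in> sets SO2_borel" for J A
    using that
  proof (induction J)
    case empty
    show ?case by (simp add: prob_space)
  next
    case (insert l J)
    have "prob {\<omega> \<in> space M. \<gamma> l \<omega> \<in> A l \<and> (\<forall>j\<in>J. \<gamma> j \<omega> \<in> A j)}
        = measure uniform_SO2 (A l) * prob {\<omega> \<in> space M. \<forall>j\<in>J. \<gamma> j \<omega> \<in> A j}"
      using insert.hyps insert.prems i
      by (intro alignment_uniform_given_others[OF ind _ _ _ _ _ _ _, of l i _ _ _ "\<lambda>_. i" "\<lambda>j. j"] inv \<gamma> al) auto
    with insert show ?case by simp
  qed
  show ?thesis
    unfolding indep_vars_def2
  proof (intro conjI ballI indep_setsI)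
    fix A J assume J: "J \<noteq> {}" "J \<subseteq> I - {i}" "finite J"
      and A: "\<forall>j\<in>J. A j \<in> {\<gamma> j -` B \<inter> space M |B. B \<in> sets SO2_borel}"
    have "\<forall>j\<in>J. \<exists>B. B \<in> sets SO2_borel \<and> A j = {\<omega> \<in> space M. \<gamma> j \<omega> \<in> B}"
      using A by (fastforce simp: vimage_def Int_def conj_commute)
    from bchoice[OF this] obtain B where "\<forall>j\<in>J. B j \<in> sets SO2_borel \<and> A j = {\<omega> \<in> space M. \<gamma> j \<omega> \<in> B j}"
      by blast
    then have B: "\<And>j. j \<in> J \<Longrightarrow> B j \<in> sets SO2_borel"
      "\<And>j. j \<in> J \<Longrightarrow> A j = {\<omega> \<in> space M. \<gamma> j \<omega> \<in> B j}"
      by blast+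
    have "(\<Inter>j\<in>J. A j) = {\<omega> \<in> space M. \<forall>j\<in>J. \<gamma> j \<omega> \<in> B j}"
      using B(2) J(1) by auto
    moreover have "prob (A j) = measure uniform_SO2 (B j)" if "j \<in> J" for j
      using prod[of "{j}" B] that J(2) B by auto
    ultimately show "prob (\<Inter>j\<in>J. A j) = (\<Prod>j\<in>J. prob (A j))"
      using prod[OF J(3,2) B(1)] by simp
  qed (use \<gamma> in auto)
qed

end

theorem lemma4p3:
  fixes M :: "'w measure"
    and n :: nat
    and Z :: "nat \<Rightarrow> 'w \<Rightarrow> real^2 \<Rightarrow> real"
    and g :: "nat \<Rightarrow> nat \<Rightarrow> 'w \<Rightarrow> real^2^2"
  assumes "prob_space M"
    and Z: "\<And>i. i \<in> {1..n} \<Longrightarrow> Z i \<in> measurable M L2_borel"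
    and g: "\<And>i j. i \<in> {1..n} \<Longrightarrow> j \<in> {1..n} \<Longrightarrow> i \<noteq> j \<Longrightarrow> g i j \<in> measurable M SO2_borel"
    and argmin: "\<And>i j. i \<in> {1..n} \<Longrightarrow> j \<in> {1..n} \<Longrightarrow> i \<noteq> j \<Longrightarrow>
      AE \<omega> in M. is_alignment (Z i \<omega>) (Z j \<omega>) (g i j \<omega>)"
  shows
    "(\<forall>i\<in>{1..n}. \<forall>j\<in>{1..n}. i \<noteq> j \<longrightarrow>
        prob_space.indep_var M L2_borel (Z i) L2_borel (Z j) \<longrightarrow>
        prob_space.rotation_invariant M (Z i) \<longrightarrow>
        prob_space.rotation_invariant M (Z j) \<longrightarrow>
          prob_space.indep_var_het M SO2_borel (g i j) L2_borel (Z i) \<and>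
          prob_space.indep_var_het M SO2_borel (g i j) L2_borel (Z j) \<and>
          distr M SO2_borel (g i j) = uniform_SO2) \<and>
     (\<forall>i\<in>{1..n}. \<forall>j\<in>{1..n}. \<forall>k\<in>{1..n}. i \<noteq> j \<longrightarrow> i \<noteq> k \<longrightarrow> j \<noteq> k \<longrightarrow>
        prob_space.indep_vars M (\<lambda>_. L2_borel) Z {i, j, k} \<longrightarrow>
        (\<forall>l\<in>{i, j, k}. prob_space.rotation_invariant M (Z l)) \<longrightarrow>
          prob_space.indep_var M SO2_borel (g i j) SO2_borel (g i k) \<and>
          prob_space.indep_var M SO2_borel (g i j) SO2_borel (g j k)) \<and>
     (prob_space.indep_vars M (\<lambda>_. L2_borel) Z {1..n} \<longrightarrow>
        (\<forall>l\<in>{1..n}. prob_space.rotation_invariant M (Z l)) \<longrightarrow>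
          (\<forall>i\<in>{1..n}.
             prob_space.indep_vars M (\<lambda>_. SO2_borel) (\<lambda>j. g i j) ({1..n} - {i})))"
proof -
  interpret prob_space M by fact
  show ?thesis
  proof (intro conjI ballI impI)
    fix i j assume ij: "i \<in> {1..n}" "j \<in> {1..n}" "i \<noteq> j"
      and ind: "indep_var L2_borel (Z i) L2_borel (Z j)"
      and inv: "rotation_invariant (Z i)" "rotation_invariant (Z j)"
    have het: "indep_var_het L2_borel (Z i) L2_borel (Z j)"
      using ind by (simp add: indep_var_iff_het)
    note gm [measurable] = g[OF ij] and al = argmin[OF ij]
    show "indep_var_het SO2_borel (g i j) L2_borel (Z i)" "distr M SO2_borel (g i j) = uniform_SO2"
      using alignment_indep_uniform[OF het inv(2) measurable_ident gm] al by auto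
    \<comment> \<open>exchange the roles of the two functions and rotate \<open>Z i\<close> instead\<close>
    have "AE \<omega> in M. is_alignment (id (Z j \<omega>)) (Z i \<omega>) (transpose (g i j \<omega>))"
      using al AE_space
    proof eventually_elim
      case (elim \<omega>)
      then show ?case
        using measurable_space[OF Z[OF ij(1)] elim(2)] measurable_space[OF Z[OF ij(2)] elim(2)]
        by (auto intro: is_alignment_transpose)
    qed
    moreover have "random_variable SO2_borel (\<lambda>\<omega>. transpose (g i j \<omega>))" by measurable
    ultimately have "indep_var_het SO2_borel (\<lambda>\<omega>. transpose (g i j \<omega>)) L2_borel (Z j)"
      using alignment_indep_uniform(1)[OF indep_var_het_sym[OF het] inv(1) measurable_ident] by blast
    from indep_var_het_compose[OF indep_var_het_sym[OF this] transpose_measurable]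
    have "indep_var_het L2_borel (Z j) SO2_borel (g i j)" by simp
    then show "indep_var_het SO2_borel (g i j) L2_borel (Z j)"
      by (rule indep_var_het_sym)
  next
    fix i j k assume ijk: "i \<in> {1..n}" "j \<in> {1..n}" "k \<in> {1..n}" "i \<noteq> j" "i \<noteq> k" "j \<noteq> k"
      and ind: "indep_vars (\<lambda>_. L2_borel) Z {i, j, k}"
      and inv: "\<forall>l\<in>{i, j, k}. rotation_invariant (Z l)"
    show "indep_var SO2_borel (g i j) SO2_borel (g i k)"
      using ijk inv by (intro alignments_indep_var[OF ind, of k i i j] g argmin) auto
    show "indep_var SO2_borel (g i j) SO2_borel (g j k)"
      using ijk inv by (intro alignments_indep_var[OF ind, of k j i j] g argmin) auto
  next
    fix i assume i: "i \<in> {1..n}" and ind: "indep_vars (\<lambda>_. L2_borel) Z {1..n}"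
      and inv: "\<forall>l\<in>{1..n}. rotation_invariant (Z l)"
    show "indep_vars (\<lambda>_. SO2_borel) (\<lambda>j. g i j) ({1..n} - {i})"
      using i inv by (intro star_alignments_indep_vars[OF ind] g argmin) auto
  qed
qed

end
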